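(* Let $E$ be a finite directed graph (finitely many vertices and edges) and let $K$ be a field. Then every primitive ideal $P$ of the Leavitt path algebra $L=L_K(E)$ is strongly primitive.
   Context: Ideals are two-sided. A directed graph $E=(E^0,E^1,r,s)$ consists of sets $E^0$ (vertices), $E^1$ (edges) and maps $r,s:E^1\to E^0$. A vertex is regular if it emits a non-empty finite set of edges, and an infinite emitter if it emits infinitely many edges. A path of length $n>0$ is a sequence of edges $\mu=e_1\cdots e_n$ with $r(e_i)=s(e_{i+1})$; vertices are paths of length $0$. Write $u\ge v$ if there is a path from $u$ to $v$. A path $e_1\cdots e_n$ of positive length is closed if $r(e_n)=s(e_1)$, and a closed path is a cycle if $s(e_i)\ne s(e_j)$ for $i\neq j$. An exit for $e_1\cdots e_n$ is an edge $f$ with $s(f)=s(e_i)$ and $f\ne e_i$ for some $i$. $E$ satisfies Condition (L) if every cycle in $E$ has an exit in $E$. A non-empty set $D$ of vertices is downward directed if for all $u,v\in D$ there is $w\in D$ with $u\ge w$ and $v\ge w$; a graph is downward directed if its vertex set is. A set $H\subseteq E^0$ is hereditary if $v\in H$, $v\ge w$ imply $w\in H$; it is saturated if for every regular vertex $v$, $r(s^{-1}(v))\subseteq H$ implies $v\in H$. Leavitt path algebra: $L_K(E)$ is the $K$-algebra generated by pairwise orthogonal idempotents $\{v: v\in E^0\}$ and elements $\{e,e^*: e\in E^1\}$ subject to: $s(e)e=e=e\,r(e)$; $r(e)e^*=e^*=e^*s(e)$; $e^*e=r(e)$ and $e^*f=0$ for $e\ne f$ in $E^1$; and $v=\sum_{s(e)=v}ee^*$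 for every regular vertex $v$. It is $\mathbb{Z}$-graded by $\deg v=0$, $\deg e=1$, $\deg e^*=-1$. An ideal $I$ is graded if $I=\bigoplus_n (I\cap L_n)$; $gr(P)$ denotes the graded part of $P$, i.e. the largest graded ideal contained in $P$. Admissible pairs and quotient graphs: for a hereditary saturated $H$, a breaking vertex of $H$ is an infinite emitter $w\in E^0\setminus H$ with $0<|s^{-1}(w)\cap r^{-1}(E^0\setminus H)|<\infty$; $B_H$ is the set of breaking vertices. For $v\in B_H$, $v^H:=v-\sum_{s(e)=v,\ r(e)\notin H}ee^*$. For $S\subseteq B_H$, $(H,S)$ is an admissible pair and $I(H,S)$ is the ideal generated by $H\cup\{v^H:v\in S\}$. The graded ideals of $L_K(E)$ are precisely the ideals $I(H,S)$. The quotient graph $E\setminus(H,S)$ has vertex set $(E^0\setminus H)\cup\{v':v\in B_H\setminus S\}$ and edge set $\{e\in E^1:r(e)\notin H\}\cup\{e':e\in E^1,\ r(e)\in B_H\setminus S\}$, with $r,s$ extended by $s(e')=s(e)$, $r(e')=r(e)'$. (For a finite graph $B_H=\emptyset$.) Strong CSP: a graph $E$ satisfies the strong CSP if there is a countable set $S\subseteq E^0$ such that for every $u\in E^0$ there is $v\in S$ with $u\ge v$, and $S$ is contained in every non-empty hereditary saturated subset of $E^0$. Strongly primitive: an ideal $P$ of $L_K(E)$ with graded part $gr(P)=I(H,S)$ is strongly primitive if the quotient graph $E\setminus(H,S)$ is downward directed and satisfies both Condition (L) and the strong CSP; in addition, every non-graded prime ideal of $L_K(E)$ is regarded as strongly primitive.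 *)

theory Defs
  imports
    "Graph_Theory.Arc_Walk"
    "HOL-Library.Countable_Set"
    "HOL-Library.Poly_Mapping"
    "HOL-Algebra.QuotRing"
    "HOL-Algebra.Module"
    "HOL-Algebra.Ideal_Product"
begin

section \<open>Directed graphs\<close>

text \<open>
  A directed graph is a \<^type>\<open>pre_digraph\<close> satisfying \<^locale>\<open>wf_digraph\<close>, with
  \<^const>\<open>tail\<close> as source map $s$ and \<^const>\<open>head\<close> as range map $r$; multiple edges and
  loops are allowed. The relation $u \ge v$ is \<^const>\<open>reachable\<close>, which on vertices includes
  the paths of length $0$.
\<close>

definition regular_vertex :: "('v, 'e) pre_digraph \<Rightarrow> 'v \<Rightarrow> bool" where
  "regular_vertex E v \<longleftrightarrow> v \<in> verts E \<and> out_arcs E v \<noteq> {} \<and> finite (out_arcs E v)"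

definition infinite_emitter :: "('v, 'e) pre_digraph \<Rightarrow> 'v \<Rightarrow> bool" where
  "infinite_emitter E v \<longleftrightarrow> v \<in> verts E \<and> infinite (out_arcs E v)"

definition is_cycle :: "('v, 'e) pre_digraph \<Rightarrow> 'e list \<Rightarrow> bool" where
  "is_cycle E p \<longleftrightarrow>
     p \<noteq> [] \<and> (\<exists>u. pre_digraph.awalk E u p u) \<and> distinct (map (tail E) p)"

definition is_exit :: "('v, 'e) pre_digraph \<Rightarrow> 'e list \<Rightarrow> 'e \<Rightarrow> bool" where
  "is_exit E p f \<longleftrightarrow> f \<in> arcs E \<and> (\<exists>e\<in>set p. tail E f = tail E e \<and> f \<noteq> e)"

definition condition_L :: "('v, 'e) pre_digraph \<Rightarrow> bool" where
  "condition_L E \<longleftrightarrow> (\<forall>p. is_cycle E p \<longrightarrow> (\<exists>f. is_exit E p f))"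

definition downward_directed_graph :: "('v, 'e) pre_digraph \<Rightarrow> bool" where
  "downward_directed_graph E \<longleftrightarrow> verts E \<noteq> {} \<and>
     (\<forall>u\<in>verts E. \<forall>v\<in>verts E. \<exists>w\<in>verts E. reachable E u w \<and> reachable E v w)"

definition hereditary :: "('v, 'e) pre_digraph \<Rightarrow> 'v set \<Rightarrow> bool" where
  "hereditary E H \<longleftrightarrow> H \<subseteq> verts E \<and> (\<forall>v\<in>H. \<forall>w. reachable E v w \<longrightarrow> w \<in> H)"

definition saturated :: "('v, 'e) pre_digraph \<Rightarrow> 'v set \<Rightarrow> bool" where
  "saturated E H \<longleftrightarrow> (\<forall>v. regular_vertex E v \<and> head E ` out_arcs E v \<subseteq> H \<longrightarrow> v \<in> H)"

definition strong_CSP :: "('v, 'e) pre_digraph \<Rightarrow> bool" where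
  "strong_CSP E \<longleftrightarrow> (\<exists>S \<subseteq> verts E. countable S \<and>
     (\<forall>u\<in>verts E. \<exists>v\<in>S. reachable E u v) \<and>
     (\<forall>H. H \<noteq> {} \<and> hereditary E H \<and> saturated E H \<longrightarrow> S \<subseteq> H))"

definition breaking_vertices :: "('v, 'e) pre_digraph \<Rightarrow> 'v set \<Rightarrow> 'v set" where
  "breaking_vertices E H = {w \<in> verts E - H. infinite_emitter E w \<and>
     {e \<in> out_arcs E w. head E e \<notin> H} \<noteq> {} \<and> finite {e \<in> out_arcs E w. head E e \<notin> H}}"

definition admissible_pair :: "('v, 'e) pre_digraph \<Rightarrow> 'v set \<Rightarrow> 'v set \<Rightarrow> bool" where
  "admissible_pair E H S \<longleftrightarrow> hereditary E H \<and> saturated E H \<and> S \<subseteq> breaking_vertices E H"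

text \<open>In the quotient graph, \<^const>\<open>Inl\<close> embeds the old vertices and edges, and
  \<^const>\<open>Inr\<close> marks the primed copies $v'$ and $e'$.\<close>

definition quotient_graph ::
  "('v, 'e) pre_digraph \<Rightarrow> 'v set \<Rightarrow> 'v set \<Rightarrow> ('v + 'v, 'e + 'e) pre_digraph" where
  "quotient_graph E H S =
    \<lparr> verts = Inl ` (verts E - H) \<union> Inr ` (breaking_vertices E H - S),
      arcs = Inl ` {e \<in> arcs E. head E e \<notin> H} \<union>
             Inr ` {e \<in> arcs E. head E e \<in> breaking_vertices E H - S},
      tail = case_sum (\<lambda>e. Inl (tail E e)) (\<lambda>e. Inl (tail E e)),
      head = case_sum (\<lambda>e. Inl (head E e)) (\<lambda>e. Inr (head E e)) \<rparr>"


section \<open>Free associative algebras\<close>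

text \<open>Words under concatenation, written additively because \<^type>\<open>poly_mapping\<close> takes the
  convolution product with respect to a \<^class>\<open>monoid_add\<close>.\<close>

datatype 'x free_word = Word (letters: "'x list")

instantiation free_word :: (type) monoid_add
begin

definition zero_free_word :: "'x free_word" where
  "zero_free_word = Word []"

definition plus_free_word :: "'x free_word \<Rightarrow> 'x free_word \<Rightarrow> 'x free_word" where
  "plus_free_word a b = Word (letters a @ letters b)"

instance
  by standard (simp_all add: zero_free_word_def plus_free_word_def)

end

type_synonym ('x, 'k) ncpoly = "'x free_word \<Rightarrow>\<^sub>0 'k"

text \<open>The free unital algebra on the set \<open>X\<close> over the field \<open>'k\<close>.\<close>

definition free_algebra :: "'x set \<Rightarrow> ('x, 'k::field) ncpoly ring" where
  "free_algebra X =
    \<lparr> carrier = {p. \<forall>w\<in>Poly_Mapping.keys p. set (letters w) \<subseteq> X},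
      mult = (*), one = 1, zero = 0, add = (+) \<rparr>"

definition gen :: "'x \<Rightarrow> ('x, 'k::field) ncpoly" where
  "gen x = Poly_Mapping.single (Word [x]) 1"

text \<open>The free non-unital algebra inside it: no constant term.\<close>

definition nonunital_part :: "'x set \<Rightarrow> ('x, 'k::field) ncpoly set" where
  "nonunital_part X = {p \<in> carrier (free_algebra X). Poly_Mapping.lookup p 0 = 0}"


section \<open>Leavitt path algebras\<close>

datatype ('v, 'e) lpa_gen = Vertex 'v | Edge 'e | Ghost 'e

type_synonym ('v, 'e, 'k) lpa_poly = "(('v, 'e) lpa_gen, 'k) ncpoly"

definition lpa_gens :: "('v, 'e) pre_digraph \<Rightarrow> ('v, 'e) lpa_gen set" where
  "lpa_gens E = Vertex ` verts E \<union> Edge ` arcs E \<union> Ghost ` arcs E"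

definition lpa_relations :: "('v, 'e) pre_digraph \<Rightarrow> ('v, 'e, 'k::field) lpa_poly set" where
  "lpa_relations E =
     {gen (Vertex v) * gen (Vertex v) - gen (Vertex v) | v. v \<in> verts E} \<union>
     {gen (Vertex v) * gen (Vertex w) | v w. v \<in> verts E \<and> w \<in> verts E \<and> v \<noteq> w} \<union>
     {gen (Vertex (tail E e)) * gen (Edge e) - gen (Edge e) | e. e \<in> arcs E} \<union>
     {gen (Edge e) * gen (Vertex (head E e)) - gen (Edge e) | e. e \<in> arcs E} \<union>
     {gen (Vertex (head E e)) * gen (Ghost e) - gen (Ghost e) | e. e \<in> arcs E} \<union>
     {gen (Ghost e) * gen (Vertex (tail E e)) - gen (Ghost e) | e. e \<in> arcs E} \<union>
     {gen (Ghost e) * gen (Edge e) - gen (Vertex (head E e)) | e. e \<in> arcs E} \<union>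
     {gen (Ghost e) * gen (Edge f) | e f. e \<in> arcs E \<and> f \<in> arcs E \<and> e \<noteq> f} \<union>
     {gen (Vertex v) - (\<Sum>e\<in>out_arcs E v. gen (Edge e) * gen (Ghost e)) | v. regular_vertex E v}"

definition lpa_ideal :: "('v, 'e) pre_digraph \<Rightarrow> ('v, 'e, 'k::field) lpa_poly set" where
  "lpa_ideal E = Idl\<^bsub>free_algebra (lpa_gens E)\<^esub> (lpa_relations E)"

definition lpa_class ::
  "('v, 'e) pre_digraph \<Rightarrow> ('v, 'e, 'k::field) lpa_poly \<Rightarrow> ('v, 'e, 'k) lpa_poly set" where
  "lpa_class E p = lpa_ideal E +>\<^bsub>free_algebra (lpa_gens E)\<^esub> p"

text \<open>
  $L_K(E)$ is presented as a non-unital algebra: the classes of the polynomials without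
  constant term. All relations have zero constant term, so this is the quotient of the free
  non-unital algebra by the ideal generated by the relations. The field \<^const>\<open>one\<close> is the
  class of the sum of all vertices, which is the identity element of $L_K(E)$ when the vertex
  set is finite (see \<open>ring_leavitt_path_algebra\<close> below); it is meaningless for infinite
  vertex sets.
\<close>

definition leavitt_path_algebra ::
  "('v, 'e) pre_digraph \<Rightarrow> ('v, 'e, 'k::field) lpa_poly set ring" where
  "leavitt_path_algebra E =
     (free_algebra (lpa_gens E) Quot lpa_ideal E)
       \<lparr> carrier := lpa_class E ` nonunital_part (lpa_gens E),
         one := lpa_class E (\<Sum>v\<in>verts E. gen (Vertex v)) \<rparr>"

fun gen_degree :: "('v, 'e) lpa_gen \<Rightarrow> int" where
  "gen_degree (Vertex v) = 0"
| "gen_degree (Edge e) = 1"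
| "gen_degree (Ghost e) = -1"

definition word_degree :: "('v, 'e) lpa_gen free_word \<Rightarrow> int" where
  "word_degree w = sum_list (map gen_degree (letters w))"

definition lpa_component ::
  "('v, 'e) pre_digraph \<Rightarrow> int \<Rightarrow> ('v, 'e, 'k::field) lpa_poly set set" where
  "lpa_component E n =
     lpa_class E ` {p \<in> nonunital_part (lpa_gens E). \<forall>w\<in>Poly_Mapping.keys p. word_degree w = n}"

text \<open>$I = \bigoplus_n (I \cap L_n)$; directness of the sum is inherited from
  $L = \bigoplus_n L_n$, so only the spanning part is a condition on $I$.\<close>

definition graded_ideal ::
  "('v, 'e) pre_digraph \<Rightarrow> ('v, 'e, 'k::field) lpa_poly set set \<Rightarrow> bool" where
  "graded_ideal E I \<longleftrightarrow> ideal I (leavitt_path_algebra E) \<and>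
     (\<forall>a\<in>I. \<exists>N f. finite N \<and> (\<forall>n\<in>N. f n \<in> I \<inter> lpa_component E n) \<and>
        a = (\<Oplus>\<^bsub>leavitt_path_algebra E\<^esub>n\<in>N. f n))"

definition graded_part ::
  "('v, 'e) pre_digraph \<Rightarrow> ('v, 'e, 'k::field) lpa_poly set set \<Rightarrow> ('v, 'e, 'k) lpa_poly set set"
  where "graded_part E P = (GREATEST J. graded_ideal E J \<and> J \<subseteq> P)"

text \<open>The polynomial representing $v^H = v - \sum_{s(e)=v,\, r(e)\notin H} ee^*$; the sum is finite
  for $v \in B_H$.\<close>

definition breaking_poly ::
  "('v, 'e) pre_digraph \<Rightarrow> 'v set \<Rightarrow> 'v \<Rightarrow> ('v, 'e, 'k::field) lpa_poly" where
  "breaking_poly E H v = gen (Vertex v) -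
     (\<Sum>e\<in>{e \<in> out_arcs E v. head E e \<notin> H}. gen (Edge e) * gen (Ghost e))"

definition pair_ideal ::
  "('v, 'e) pre_digraph \<Rightarrow> 'v set \<Rightarrow> 'v set \<Rightarrow> ('v, 'e, 'k::field) lpa_poly set set" where
  "pair_ideal E H S = Idl\<^bsub>leavitt_path_algebra E\<^esub>
     ((\<lambda>v. lpa_class E (gen (Vertex v))) ` H \<union> (\<lambda>v. lpa_class E (breaking_poly E H v)) ` S)"


section \<open>Prime, primitive and strongly primitive ideals\<close>

text \<open>The ring theory of \<^theory>\<open>HOL-Algebra.Ideal\<close> and \<^theory>\<open>HOL-Algebra.Module\<close>
  provides prime ideals and modules over commutative rings only, so the general notions are
  defined here.\<close>

definition nc_prime_ideal :: "('a, 'b) ring_scheme \<Rightarrow> 'a set \<Rightarrow> bool" where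
  "nc_prime_ideal R P \<longleftrightarrow> ideal P R \<and> P \<noteq> carrier R \<and>
     (\<forall>A B. ideal A R \<and> ideal B R \<and> ideal_prod R A B \<subseteq> P \<longrightarrow> A \<subseteq> P \<or> B \<subseteq> P)"

locale left_module = R?: ring R + M?: abelian_group M
  for R :: "('a, 'c) ring_scheme" and M :: "('a, 'm, 'd) module_scheme" (structure) +
  assumes smult_closed:
      "\<lbrakk>a \<in> carrier R; x \<in> carrier M\<rbrakk> \<Longrightarrow> a \<odot>\<^bsub>M\<^esub> x \<in> carrier M"
    and smult_l_distr:
      "\<lbrakk>a \<in> carrier R; b \<in> carrier R; x \<in> carrier M\<rbrakk> \<Longrightarrow>
        (a \<oplus>\<^bsub>R\<^esub> b) \<odot>\<^bsub>M\<^esub> x = a \<odot>\<^bsub>M\<^esub> x \<oplus>\<^bsub>M\<^esub> b \<odot>\<^bsub>M\<^esub> x"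
    and smult_r_distr:
      "\<lbrakk>a \<in> carrier R; x \<in> carrier M; y \<in> carrier M\<rbrakk> \<Longrightarrow>
        a \<odot>\<^bsub>M\<^esub> (x \<oplus>\<^bsub>M\<^esub> y) = a \<odot>\<^bsub>M\<^esub> x \<oplus>\<^bsub>M\<^esub> a \<odot>\<^bsub>M\<^esub> y"
    and smult_assoc:
      "\<lbrakk>a \<in> carrier R; b \<in> carrier R; x \<in> carrier M\<rbrakk> \<Longrightarrow>
        (a \<otimes>\<^bsub>R\<^esub> b) \<odot>\<^bsub>M\<^esub> x = a \<odot>\<^bsub>M\<^esub> (b \<odot>\<^bsub>M\<^esub> x)"
    and smult_one: "x \<in> carrier M \<Longrightarrow> \<one>\<^bsub>R\<^esub> \<odot>\<^bsub>M\<^esub> x = x"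

definition simple_left_module ::
  "('a, 'c) ring_scheme \<Rightarrow> ('a, 'm, 'd) module_scheme \<Rightarrow> bool" where
  "simple_left_module R M \<longleftrightarrow> left_module R M \<and> carrier M \<noteq> {\<zero>\<^bsub>M\<^esub>} \<and>
     (\<forall>N. submodule N R M \<longrightarrow> N = {\<zero>\<^bsub>M\<^esub>} \<or> N = carrier M)"

definition module_annihilator ::
  "('a, 'c) ring_scheme \<Rightarrow> ('a, 'm, 'd) module_scheme \<Rightarrow> 'a set" where
  "module_annihilator R M = {a \<in> carrier R. \<forall>x\<in>carrier M. a \<odot>\<^bsub>M\<^esub> x = \<zero>\<^bsub>M\<^esub>}"

text \<open>(Left) primitive ideals. The type argument \<open>'m\<close> is the type in which the elements of
  the simple module live; a theorem assuming \<open>primitive_ideal TYPE('m) R P\<close> with a free type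
  variable \<open>'m\<close> covers simple modules in every type.\<close>

definition primitive_ideal ::
  "'m itself \<Rightarrow> ('a, 'c) ring_scheme \<Rightarrow> 'a set \<Rightarrow> bool" where
  "primitive_ideal _ R P \<longleftrightarrow>
     (\<exists>M :: ('a, 'm) module. simple_left_module R M \<and> P = module_annihilator R M)"

definition strongly_primitive ::
  "('v, 'e) pre_digraph \<Rightarrow> ('v, 'e, 'k::field) lpa_poly set set \<Rightarrow> bool" where
  "strongly_primitive E P \<longleftrightarrow>
     (ideal P (leavitt_path_algebra E) \<and>
       (\<exists>H S. admissible_pair E H S \<and> graded_part E P = pair_ideal E H S \<and>
          downward_directed_graph (quotient_graph E H S) \<and>
          condition_L (quotient_graph E H S) \<and>
          strong_CSP (quotient_graph E H S))) \<or>
     (nc_prime_ideal (leavitt_path_algebra E) P \<and> \<not> graded_ideal E P)"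


section \<open>$L_K(E)$ is a unital ring for graphs with finitely many vertices\<close>

lemma free_algebra_carrier_iff:
  "p \<in> carrier (free_algebra X) \<longleftrightarrow> (\<forall>w\<in>Poly_Mapping.keys p. set (letters w) \<subseteq> X)"
  by (simp add: free_algebra_def)

lemma free_algebra_simps [simp]:
  "mult (free_algebra X) = (*)" "one (free_algebra X) = 1"
  "zero (free_algebra X) = 0" "add (free_algebra X) = (+)"
  by (simp_all add: free_algebra_def)

lemma free_algebra_closed:
  fixes p q :: "('x, 'k::field) ncpoly"
  assumes "p \<in> carrier (free_algebra X)" "q \<in> carrier (free_algebra X)"
  shows "p + q \<in> carrier (free_algebra X)" "p * q \<in> carrier (free_algebra X)"
    "- p \<in> carrier (free_algebra X)" "p - q \<in> carrier (free_algebra X)"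
proof -
  show "p + q \<in> carrier (free_algebra X)"
    using assms Poly_Mapping.keys_add[of p q] by (auto simp: free_algebra_carrier_iff)
  show "p * q \<in> carrier (free_algebra X)"
    using assms keys_mult[of p q] by (fastforce simp: free_algebra_carrier_iff plus_free_word_def)
  show "- p \<in> carrier (free_algebra X)"
    using assms by (simp add: free_algebra_carrier_iff)
  show "p - q \<in> carrier (free_algebra X)"
    using assms keys_diff[of p q] by (auto simp: free_algebra_carrier_iff)
qed

lemma free_algebra_const [simp]:
  "0 \<in> carrier (free_algebra X)" "1 \<in> carrier (free_algebra X)"
  by (simp_all add: free_algebra_carrier_iff zero_free_word_def)

lemma ring_free_algebra: "ring (free_algebra X :: ('x, 'k::field) ncpoly ring)"
proof (rule ringI)
  show "abelian_group (free_algebra X :: ('x, 'k) ncpoly ring)"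
  proof (rule abelian_groupI)
    fix p :: "('x, 'k) ncpoly" assume "p \<in> carrier (free_algebra X)"
    then show "\<exists>q\<in>carrier (free_algebra X). q \<oplus>\<^bsub>free_algebra X\<^esub> p = \<zero>\<^bsub>free_algebra X\<^esub>"
      by (intro bexI[of _ "- p"]) (auto intro: free_algebra_closed)
  qed (auto simp: algebra_simps intro: free_algebra_closed)
  show "Group.monoid (free_algebra X :: ('x, 'k) ncpoly ring)"
    by (rule monoidI) (auto simp: algebra_simps intro: free_algebra_closed)
qed (auto simp: algebra_simps)

lemma gen_in_free_algebra: "gen x \<in> carrier (free_algebra X) \<longleftrightarrow> x \<in> X"
  by (simp add: gen_def free_algebra_carrier_iff)

lemma free_algebra_sum:
  "(\<And>i. i \<in> I \<Longrightarrow> f i \<in> carrier (free_algebra X)) \<Longrightarrow>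
    (\<Sum>i\<in>I. f i) \<in> carrier (free_algebra X :: ('x, 'k::field) ncpoly ring)"
  by (induction I rule: infinite_finite_induct)
    (auto intro: free_algebra_closed)

lemma lookup_zero_mult:
  fixes p q :: "('x, 'k::field) ncpoly"
  assumes "Poly_Mapping.lookup p 0 = 0 \<or> Poly_Mapping.lookup q 0 = 0"
  shows "Poly_Mapping.lookup (p * q) 0 = 0"
proof -
  have "0 \<notin> Poly_Mapping.keys (p * q)"
  proof
    assume "0 \<in> Poly_Mapping.keys (p * q)"
    then obtain a b where "a \<in> Poly_Mapping.keys p" "b \<in> Poly_Mapping.keys q" "0 = a + b"
      using keys_mult[of p q] by auto
    moreover from this have "a = 0" "b = 0"
      by (cases a; cases b; simp add: zero_free_word_def plus_free_word_def)+
    ultimately show False using assms by (simp add: in_keys_iff)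
  qed
  then show ?thesis by (simp add: in_keys_iff)
qed

lemma nonunital_part_closed:
  fixes p q :: "('x, 'k::field) ncpoly"
  assumes "p \<in> nonunital_part X" "q \<in> nonunital_part X"
  shows "p + q \<in> nonunital_part X" "p * q \<in> nonunital_part X" "- p \<in> nonunital_part X"
    "0 \<in> nonunital_part X"
  using assms free_algebra_closed[of p X q]
  by (auto simp: nonunital_part_def lookup_zero_mult lookup_add)

lemma nonunital_sum:
  "(\<And>i. i \<in> I \<Longrightarrow> f i \<in> nonunital_part X) \<Longrightarrow>
    (\<Sum>i\<in>I. f i) \<in> (nonunital_part X :: ('x, 'k::field) ncpoly set)"
proof (induction I rule: infinite_finite_induct)
  case (insert i I)
  then show ?case using nonunital_part_closed(1)[of "f i" X "\<Sum>i\<in>I. f i"] by simp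
qed (simp_all add: nonunital_part_def)

lemma gen_nonunital: "x \<in> X \<Longrightarrow> gen x \<in> nonunital_part X"
  by (simp add: nonunital_part_def gen_in_free_algebra) (simp add: gen_def lookup_single zero_free_word_def)

lemma lpa_relations_carrier:
  assumes "wf_digraph E"
  shows "lpa_relations E \<subseteq> (carrier (free_algebra (lpa_gens E)) :: ('v, 'e, 'k::field) lpa_poly set)"
proof -
  interpret wf_digraph E by fact
  have "Vertex v \<in> lpa_gens E" if "v \<in> verts E" for v using that by (simp add: lpa_gens_def)
  moreover have "Edge e \<in> lpa_gens E" "Ghost e \<in> lpa_gens E" if "e \<in> arcs E" for e
    using that by (simp_all add: lpa_gens_def)
  ultimately show ?thesis
    unfolding lpa_relations_def regular_vertex_def
    by (auto
        intro!: free_algebra_closed free_algebra_sum simp: gen_in_free_algebra)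
qed

lemma ideal_lpa_ideal:
  assumes "wf_digraph E"
  shows "ideal (lpa_ideal E) (free_algebra (lpa_gens E) :: ('v, 'e, 'k::field) lpa_poly ring)"
  unfolding lpa_ideal_def
  by (rule ring.genideal_ideal[OF ring_free_algebra lpa_relations_carrier[OF assms]])

lemma lpa_class_ops:
  fixes p q :: "('v, 'e, 'k::field) lpa_poly"
  assumes "wf_digraph E" "p \<in> nonunital_part (lpa_gens E)" "q \<in> nonunital_part (lpa_gens E)"
  shows "add (leavitt_path_algebra E) (lpa_class E p) (lpa_class E q) = lpa_class E (p + q)"
    and "mult (leavitt_path_algebra E) (lpa_class E p) (lpa_class E q) = lpa_class E (p * q)"
proof -
  interpret ideal "lpa_ideal E" "free_algebra (lpa_gens E) :: ('v, 'e, 'k) lpa_poly ring"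
    by (rule ideal_lpa_ideal[OF assms(1)])
  have pq: "p \<in> carrier (free_algebra (lpa_gens E))" "q \<in> carrier (free_algebra (lpa_gens E))"
    using assms by (auto simp: nonunital_part_def)
  show "add (leavitt_path_algebra E) (lpa_class E p) (lpa_class E q) = lpa_class E (p + q)"
    using a_rcos_sum[OF pq] by (simp add: leavitt_path_algebra_def FactRing_def lpa_class_def)
  show "mult (leavitt_path_algebra E) (lpa_class E p) (lpa_class E q) = lpa_class E (p * q)"
    using rcoset_mult_add[OF pq] by (simp add: leavitt_path_algebra_def FactRing_def lpa_class_def)
qed

lemma lpa_class_eqI:
  fixes p q :: "('v, 'e, 'k::field) lpa_poly"
  assumes "wf_digraph E" "p \<in> carrier (free_algebra (lpa_gens E))"
    "q \<in> carrier (free_algebra (lpa_gens E))" "p - q \<in> lpa_ideal E"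
  shows "lpa_class E p = lpa_class E q"
proof -
  interpret ideal "lpa_ideal E" "free_algebra (lpa_gens E) :: ('v, 'e, 'k) lpa_poly ring"
    by (rule ideal_lpa_ideal[OF assms(1)])
  have "p = (p - q) + q" by simp
  then have "p \<in> lpa_ideal E +>\<^bsub>free_algebra (lpa_gens E)\<^esub> q"
    using assms(4) by (force simp: a_r_coset_def')
  then show ?thesis using a_repr_independence[OF _ assms(3) a_subgroup] by (simp add: lpa_class_def)
qed

lemma lpa_ideal_closed:
  fixes p q :: "('v, 'e, 'k::field) lpa_poly"
  assumes "wf_digraph E"
  shows "p \<in> lpa_ideal E \<Longrightarrow> q \<in> lpa_ideal E \<Longrightarrow> p + q \<in> lpa_ideal E"
    and "p \<in> lpa_ideal E \<Longrightarrow> q \<in> carrier (free_algebra (lpa_gens E)) \<Longrightarrow> p * q \<in> lpa_ideal E"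
    and "p \<in> lpa_ideal E \<Longrightarrow> q \<in> carrier (free_algebra (lpa_gens E)) \<Longrightarrow> q * p \<in> lpa_ideal E"
    and "0 \<in> (lpa_ideal E :: ('v, 'e, 'k) lpa_poly set)"
proof -
  interpret ideal "lpa_ideal E" "free_algebra (lpa_gens E) :: ('v, 'e, 'k) lpa_poly ring"
    by (rule ideal_lpa_ideal[OF assms(1)])
  show "p \<in> lpa_ideal E \<Longrightarrow> q \<in> lpa_ideal E \<Longrightarrow> p + q \<in> lpa_ideal E"
    using additive_subgroup.a_closed[OF is_additive_subgroup, of p q] by simp
  show "p \<in> lpa_ideal E \<Longrightarrow> q \<in> carrier (free_algebra (lpa_gens E)) \<Longrightarrow> p * q \<in> lpa_ideal E"
    using I_r_closed[of p q] by simp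
  show "p \<in> lpa_ideal E \<Longrightarrow> q \<in> carrier (free_algebra (lpa_gens E)) \<Longrightarrow> q * p \<in> lpa_ideal E"
    using I_l_closed[of p q] by simp
  show "0 \<in> (lpa_ideal E :: ('v, 'e, 'k) lpa_poly set)"
    using additive_subgroup.zero_closed[OF is_additive_subgroup] by simp
qed

lemma lpa_ideal_sum:
  assumes "wf_digraph E" "\<And>i. i \<in> I \<Longrightarrow> f i \<in> lpa_ideal E"
  shows "(\<Sum>i\<in>I. f i) \<in> (lpa_ideal E :: ('v, 'e, 'k::field) lpa_poly set)"
  using assms(2)
  by (induction I rule: infinite_finite_induct)
    (auto intro: lpa_ideal_closed[OF assms(1)])

lemma lpa_relations_in_ideal:
  "lpa_relations E \<subseteq> (lpa_ideal E :: ('v, 'e, 'k::field) lpa_poly set)"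
  unfolding lpa_ideal_def genideal_def by blast

lemma lpa_one_gen:
  fixes E :: "('v, 'e) pre_digraph" and g :: "('v, 'e) lpa_gen"
  defines "u \<equiv> (\<Sum>v\<in>verts E. gen (Vertex v) :: ('v, 'e, 'k::field) lpa_poly)"
  assumes wf: "wf_digraph E" and fin: "finite (verts E)" and g: "g \<in> lpa_gens E"
  shows "u * gen g - gen g \<in> lpa_ideal E" "gen g * u - gen g \<in> lpa_ideal E"
proof -
  interpret wf_digraph E by fact
  have rel: "r \<in> lpa_relations E \<Longrightarrow> r \<in> lpa_ideal E" for r :: "('v, 'e, 'k) lpa_poly"
    using lpa_relations_in_ideal by blast
  have car: "gen g \<in> carrier (free_algebra (lpa_gens E))" if "g \<in> lpa_gens E" for g
    using that by (simp add: gen_in_free_algebra)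
  have ucar: "u \<in> carrier (free_algebra (lpa_gens E))"
    unfolding u_def by (intro free_algebra_sum car) (auto simp: lpa_gens_def)
  have split: "u = gen (Vertex v) + (\<Sum>w\<in>verts E - {v}. gen (Vertex w))" if "v \<in> verts E" for v
    unfolding u_def using that fin by (simp add: sum.remove)
  have vl: "u * gen (Vertex v) - gen (Vertex v) \<in> lpa_ideal E" if v: "v \<in> verts E" for v
  proof -
    have "u * gen (Vertex v) - gen (Vertex v) = (gen (Vertex v) * gen (Vertex v) - gen (Vertex v))
        + (\<Sum>w\<in>verts E - {v}. gen (Vertex w) * gen (Vertex v))"
      by (subst split[OF v]) (simp add: algebra_simps sum_distrib_right)
    also have "\<dots> \<in> lpa_ideal E"
      by (intro lpa_ideal_closed[OF wf] lpa_ideal_sum[OF wf] rel)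
         (use v in \<open>auto simp: lpa_relations_def\<close>)
    finally show ?thesis .
  qed
  have vr: "gen (Vertex v) * u - gen (Vertex v) \<in> lpa_ideal E" if v: "v \<in> verts E" for v
  proof -
    have "gen (Vertex v) * u - gen (Vertex v) = (gen (Vertex v) * gen (Vertex v) - gen (Vertex v))
        + (\<Sum>w\<in>verts E - {v}. gen (Vertex v) * gen (Vertex w))"
      by (subst split[OF v]) (simp add: algebra_simps sum_distrib_left)
    also have "\<dots> \<in> lpa_ideal E"
      by (intro lpa_ideal_closed[OF wf] lpa_ideal_sum[OF wf] rel)
         (use v in \<open>auto simp: lpa_relations_def\<close>)
    finally show ?thesis .
  qed
  have neg: "x \<in> lpa_ideal E \<Longrightarrow> - x \<in> lpa_ideal E" for x :: "('v, 'e, 'k) lpa_poly"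
    using lpa_ideal_closed(2)[OF wf, of x "-1"] free_algebra_closed(3)[of 1 "lpa_gens E" 1] by simp
  have L: "u * gen g - gen g \<in> lpa_ideal E"
    if "v \<in> verts E" "gen (Vertex v) * gen g - gen g \<in> (lpa_ideal E :: ('v, 'e, 'k) lpa_poly set)"
      "g \<in> lpa_gens E" for v g
  proof -
    have "u * gen g - gen g = u * (- (gen (Vertex v) * gen g - gen g))
       + (u * gen (Vertex v) - gen (Vertex v)) * gen g + (gen (Vertex v) * gen g - gen g)"
      by (simp add: algebra_simps)
    also have "\<dots> \<in> lpa_ideal E"
      by (intro lpa_ideal_closed(1)[OF wf] lpa_ideal_closed(2)[OF wf vl]
          lpa_ideal_closed(3)[OF wf _ ucar] neg that car)
    finally show ?thesis .
  qed
  have R: "gen g * u - gen g \<in> lpa_ideal E"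
    if "v \<in> verts E" "gen g * gen (Vertex v) - gen g \<in> (lpa_ideal E :: ('v, 'e, 'k) lpa_poly set)"
      "g \<in> lpa_gens E" for v g
  proof -
    have "gen g * u - gen g = (- (gen g * gen (Vertex v) - gen g)) * u
       + gen g * (gen (Vertex v) * u - gen (Vertex v)) + (gen g * gen (Vertex v) - gen g)"
      by (simp add: algebra_simps)
    also have "\<dots> \<in> lpa_ideal E"
      by (intro lpa_ideal_closed(1)[OF wf] lpa_ideal_closed(3)[OF wf vr]
          lpa_ideal_closed(2)[OF wf _ ucar] neg that car)
    finally show ?thesis .
  qed
  show "u * gen g - gen g \<in> lpa_ideal E"
  proof (cases g)
    case (Edge e)
    with g have "e \<in> arcs E" by (auto simp: lpa_gens_def)
    with Edge g show ?thesis
      by (intro L[of "tail E e"] rel) (auto simp: lpa_relations_def)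
  next
    case (Ghost e)
    with g have "e \<in> arcs E" by (auto simp: lpa_gens_def)
    with Ghost g show ?thesis
      by (intro L[of "head E e"] rel) (auto simp: lpa_relations_def)
  qed (use vl g in \<open>auto simp: lpa_gens_def\<close>)
  show "gen g * u - gen g \<in> lpa_ideal E"
  proof (cases g)
    case (Edge e)
    with g have "e \<in> arcs E" by (auto simp: lpa_gens_def)
    with Edge g show ?thesis
      by (intro R[of "head E e"] rel) (auto simp: lpa_relations_def)
  next
    case (Ghost e)
    with g have "e \<in> arcs E" by (auto simp: lpa_gens_def)
    with Ghost g show ?thesis
      by (intro R[of "tail E e"] rel) (auto simp: lpa_relations_def)
  qed (use vr g in \<open>auto simp: lpa_gens_def\<close>)
qed

lemma nonunital_part_decomp:
  assumes "p \<in> nonunital_part X"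
  shows "p = (\<Sum>w\<in>Poly_Mapping.keys p. Poly_Mapping.single w (Poly_Mapping.lookup p w))"
    and "\<And>w. w \<in> Poly_Mapping.keys p \<Longrightarrow> letters w \<noteq> [] \<and> set (letters w) \<subseteq> X"
proof -
  show "p = (\<Sum>w\<in>Poly_Mapping.keys p. Poly_Mapping.single w (Poly_Mapping.lookup p w))"
    by (rule poly_mapping_eqI) (simp add: lookup_sum lookup_single when_def in_keys_iff)
  fix w assume w: "w \<in> Poly_Mapping.keys p"
  then have "w \<noteq> 0" using assms by (auto simp: nonunital_part_def in_keys_iff)
  then show "letters w \<noteq> [] \<and> set (letters w) \<subseteq> X"
    using w assms by (cases w) (force simp: nonunital_part_def zero_free_word_def free_algebra_carrier_iff)
qed

lemma lpa_one:
  fixes E :: "('v, 'e) pre_digraph" and p :: "('v, 'e, 'k::field) lpa_poly"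
  defines "u \<equiv> (\<Sum>v\<in>verts E. gen (Vertex v) :: ('v, 'e, 'k::field) lpa_poly)"
  assumes wf: "wf_digraph E" and fin: "finite (verts E)" and p: "p \<in> nonunital_part (lpa_gens E)"
  shows "u * p - p \<in> lpa_ideal E" "p * u - p \<in> lpa_ideal E"
proof -
  have l: "u * Poly_Mapping.single w c - Poly_Mapping.single w c \<in> lpa_ideal E"
    if w: "letters w \<noteq> []" "set (letters w) \<subseteq> lpa_gens E" for w and c :: 'k
  proof -
    from w obtain g gs where gs: "w = Word [g] + Word gs" "g \<in> lpa_gens E" "set gs \<subseteq> lpa_gens E"
      by (cases w rule: free_word.exhaust; cases "letters w") (auto simp: plus_free_word_def)
    have s: "Poly_Mapping.single w c = gen g * Poly_Mapping.single (Word gs) c"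
      by (simp add: gs gen_def mult_single)
    have "u * Poly_Mapping.single w c - Poly_Mapping.single w c =
        (u * gen g - gen g) * Poly_Mapping.single (Word gs) c"
      unfolding s by (simp add: algebra_simps)
    then show ?thesis
      using lpa_ideal_closed(2)[OF wf lpa_one_gen(1)[OF wf fin gs(2)], of "Poly_Mapping.single (Word gs) c"]
        gs(3) by (simp add: u_def free_algebra_carrier_iff)
  qed
  have r: "Poly_Mapping.single w c * u - Poly_Mapping.single w c \<in> lpa_ideal E"
    if w: "letters w \<noteq> []" "set (letters w) \<subseteq> lpa_gens E" for w and c :: 'k
  proof -
    from w obtain g gs where gs: "w = Word gs + Word [g]" "g \<in> lpa_gens E" "set gs \<subseteq> lpa_gens E"
      by (cases w rule: free_word.exhaust; cases "letters w" rule: rev_cases)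
        (auto simp: plus_free_word_def)
    have s: "Poly_Mapping.single w c = Poly_Mapping.single (Word gs) c * gen g"
      by (simp add: gs gen_def mult_single)
    have "Poly_Mapping.single w c * u - Poly_Mapping.single w c =
        Poly_Mapping.single (Word gs) c * (gen g * u - gen g)"
      unfolding s by (simp add: algebra_simps)
    then show ?thesis
      using lpa_ideal_closed(3)[OF wf lpa_one_gen(2)[OF wf fin gs(2)], of "Poly_Mapping.single (Word gs) c"]
        gs(3) by (simp add: u_def free_algebra_carrier_iff)
  qed
  let ?m = "\<lambda>w. Poly_Mapping.single w (Poly_Mapping.lookup p w)"
  note d = nonunital_part_decomp[OF p]
  have "u * p - p = (\<Sum>w\<in>Poly_Mapping.keys p. u * ?m w - ?m w)"
    by (subst d(1), subst (3) d(1)) (simp add: sum_distrib_left sum_subtractf)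
  also have "\<dots> \<in> lpa_ideal E" using l d(2) by (intro lpa_ideal_sum[OF wf]) auto
  finally show "u * p - p \<in> lpa_ideal E" .
  have "p * u - p = (\<Sum>w\<in>Poly_Mapping.keys p. ?m w * u - ?m w)"
    by (subst d(1), subst (3) d(1)) (simp add: sum_distrib_right sum_subtractf)
  also have "\<dots> \<in> lpa_ideal E" using r d(2) by (intro lpa_ideal_sum[OF wf]) auto
  finally show "p * u - p \<in> lpa_ideal E" .
qed

theorem ring_leavitt_path_algebra:
  fixes E :: "('v, 'e) pre_digraph"
  assumes wf: "wf_digraph E" and fin: "finite (verts E)"
  shows "ring (leavitt_path_algebra E :: ('v, 'e, 'k::field) lpa_poly set ring)"
proof -
  let ?L = "leavitt_path_algebra E :: ('v, 'e, 'k) lpa_poly set ring"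
  let ?N = "nonunital_part (lpa_gens E) :: ('v, 'e, 'k) lpa_poly set"
  let ?u = "\<Sum>v\<in>verts E. gen (Vertex v) :: ('v, 'e, 'k) lpa_poly"
  interpret I: ideal "lpa_ideal E" "free_algebra (lpa_gens E) :: ('v, 'e, 'k) lpa_poly ring"
    by (rule ideal_lpa_ideal[OF wf])
  have car: "carrier ?L = lpa_class E ` ?N" and one: "\<one>\<^bsub>?L\<^esub> = lpa_class E ?u"
    by (simp_all add: leavitt_path_algebra_def)
  have zero: "\<zero>\<^bsub>?L\<^esub> = lpa_class E 0"
    using I.a_coset_add_zero[OF I.a_subset]
    by (simp add: leavitt_path_algebra_def FactRing_def lpa_class_def)
  note ops = lpa_class_ops[OF wf]
  note cl = nonunital_part_closed
  have uN: "?u \<in> ?N" by (intro nonunital_sum gen_nonunital) (simp add: lpa_gens_def)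
  have sub: "p \<in> ?N \<Longrightarrow> p \<in> carrier (free_algebra (lpa_gens E))" for p
    by (simp add: nonunital_part_def)
  have zN: "0 \<in> ?N" by (rule cl(4)[OF uN uN])
  show ?thesis
  proof (rule ringI)
    show "abelian_group ?L"
    proof (rule abelian_groupI)
      fix x assume "x \<in> carrier ?L"
      then obtain p where p: "p \<in> ?N" "x = lpa_class E p" by (auto simp: car)
      show "\<exists>y\<in>carrier ?L. y \<oplus>\<^bsub>?L\<^esub> x = \<zero>\<^bsub>?L\<^esub>"
        using p ops(1)[OF cl(3)[OF p(1) p(1)] p(1)] cl(3)[OF p(1) p(1)]
        by (intro bexI[of _ "lpa_class E (- p)"]) (auto simp: zero car)
    qed (auto simp: car zero zN ops cl algebra_simps)
    show "Group.monoid ?L"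
    proof (rule monoidI)
      fix x assume "x \<in> carrier ?L"
      then obtain p where p: "p \<in> ?N" "x = lpa_class E p" by (auto simp: car)
      show "\<one>\<^bsub>?L\<^esub> \<otimes>\<^bsub>?L\<^esub> x = x" "x \<otimes>\<^bsub>?L\<^esub> \<one>\<^bsub>?L\<^esub> = x"
        unfolding one p(2) ops(2)[OF uN p(1)] ops(2)[OF p(1) uN]
        by (intro lpa_class_eqI[OF wf] sub cl(2) uN p(1) lpa_one[OF wf fin])+
    qed (use uN in \<open>auto simp: car one ops cl algebra_simps\<close>)
  qed (auto simp: car ops cl algebra_simps)
qed

end

theory Submission
  imports Defs
begin

text \<open>
  Let \<open>P\<close> be the annihilator of a simple module. Then \<open>P\<close> is prime, as in every ring
  (\<open>primitive_imp_prime\<close>), so only the case of a graded \<open>P\<close> has content. There \<open>P\<close> is its own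
  graded part, and everything has to be read off from the set \<open>H\<close> of vertices lying in \<open>P\<close>.
  A finite graph has no breaking vertices, so the quotient graph is simply \<open>E\<close> restricted to
  the complement of \<open>H\<close>.

  The computations take place in the free unital algebra on \<^emph>\<open>all\<close> conceivable generators,
  which is a type and therefore needs no carrier conditions. It maps onto $L_K(E)$ by
  \<open>lpa_map\<close>, which kills the generators outside \<open>E\<close>, and an ideal of $L_K(E)$ becomes the
  congruence given by its preimage \<open>Q\<close> (\<open>lpa_congruence\<close>). Three arguments carry the proof.

  \<^item> \<^emph>\<open>Words act on long paths.\<close> Modulo the relations, a word times a path that is at least as
    long as the word, or that ends in a sink, is zero or again a path with the same range
    (\<open>word_on_path\<close>). By the relation $v = \sum ee^*$, the paths of length \<open>N\<close> together with the
    shorter ones ending in sinks suffice to test membership in an ideal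
    (\<open>mem_if_paths_right\<close>, \<open>mem_if_paths_left\<close>), and distinct such paths are orthogonal. So if
    \<open>p\<close> is homogeneous, then every $\mu^* p \nu$ with long \<open>\<mu>\<close>, \<open>\<nu>\<close> is a multiple of a vertex.
    Consequently a graded ideal is generated by its vertices (\<open>graded_congruence_le\<close>), that is,
    \<open>P\<close> is the ideal of the pair \<open>(H, \<emptyset>)\<close>.

  \<^item> \<^emph>\<open>Downward directedness.\<close> If $u, v \notin P$, simplicity gives $u a v \notin P$ for some \<open>a\<close>,
    which may be taken to be a word; testing on long paths from \<open>v\<close> produces a common
    descendant outside \<open>H\<close> (\<open>common_descendant\<close>). In a finite graph this yields one vertex below
    all others, which is a witness for the strong CSP.

  \<^item> \<^emph>\<open>Condition (L).\<close> Suppose that a cycle \<open>c\<close> at \<open>v\<close> has no exit in the quotient graph. Modulo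
    \<open>P\<close> there is exactly one path of each length starting at \<open>v\<close>, so words act on these paths by
    shifts, and the corner $v L v / P$ is commutative (\<open>corner_commute\<close>). A nonzero commutative
    corner of a primitive ring is a field, whereas gradedness forces $v + c$ to be nonzero and not
    invertible, just as $1 + t$ in the Laurent polynomial ring.
\<close>

section \<open>Noncommutative polynomials\<close>

definition filter_words :: "('x free_word \<Rightarrow> bool) \<Rightarrow> ('x, 'k::zero) ncpoly \<Rightarrow> ('x, 'k) ncpoly"
  where "filter_words A p = Abs_poly_mapping (\<lambda>w. if A w then Poly_Mapping.lookup p w else 0)"

lemma lookup_filter_words [simp]:
  "Poly_Mapping.lookup (filter_words A p) w = (if A w then Poly_Mapping.lookup p w else 0)"
proof -
  have "finite {w. (if A w then Poly_Mapping.lookup p w else 0) \<noteq> 0}"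
    by (rule finite_subset[OF _ finite_lookup[of p]]) auto
  then show ?thesis by (simp add: filter_words_def)
qed

lemma keys_filter_words: "Poly_Mapping.keys (filter_words A p) = {w \<in> Poly_Mapping.keys p. A w}"
  by (auto simp: in_keys_iff split: if_splits)

lemma filter_words_zero [simp]: "filter_words A 0 = 0"
  by (rule poly_mapping_eqI) simp

lemma filter_words_add: "filter_words A (p + q) = filter_words A p + filter_words A q"
  by (rule poly_mapping_eqI) (simp add: lookup_add)

lemma filter_words_diff:
  fixes p q :: "('x, 'k::field) ncpoly"
  shows "filter_words A (p - q) = filter_words A p - filter_words A q"
  by (rule poly_mapping_eqI) (simp add: lookup_minus)

lemma filter_words_sum: "filter_words A (\<Sum>i\<in>I. f i) = (\<Sum>i\<in>I. filter_words A (f i))"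
  by (induction I rule: infinite_finite_induct) (simp_all add: filter_words_add)

lemma filter_words_single:
  "filter_words A (Poly_Mapping.single w c) = (if A w then Poly_Mapping.single w c else 0)"
  by (rule poly_mapping_eqI) (simp add: lookup_single when_def)

lemma filter_words_all: "(\<And>w. w \<in> Poly_Mapping.keys p \<Longrightarrow> A w) \<Longrightarrow> filter_words A p = p"
  by (rule poly_mapping_eqI) (auto simp: in_keys_iff)

lemma filter_words_none: "(\<And>w. w \<in> Poly_Mapping.keys p \<Longrightarrow> \<not> A w) \<Longrightarrow> filter_words A p = 0"
  by (rule poly_mapping_eqI) (auto simp: in_keys_iff)

lemma filter_words_swap: "filter_words A (filter_words B p) = filter_words B (filter_words A p)"
  by (rule poly_mapping_eqI) simp

lemma ncpoly_decomp:
  "p = (\<Sum>w\<in>Poly_Mapping.keys p. Poly_Mapping.single w (Poly_Mapping.lookup p w))"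
  by (rule poly_mapping_eqI) (simp add: lookup_sum lookup_single when_def in_keys_iff)

lemma ncpoly_induct [case_names single add zero]:
  fixes p :: "('x, 'k::field) ncpoly"
  assumes "\<And>w c. Pr (Poly_Mapping.single w c)" "\<And>p q. Pr p \<Longrightarrow> Pr q \<Longrightarrow> Pr (p + q)" "Pr 0"
  shows "Pr p"
proof -
  have "Pr (\<Sum>w\<in>S. Poly_Mapping.single w (Poly_Mapping.lookup p w))" if "finite S" for S
    using that by (induction S rule: finite_induct) (auto intro: assms)
  then show ?thesis by (subst ncpoly_decomp) simp
qed

lemma filter_words_mult_single_left:
  fixes q :: "('x, 'k::field) ncpoly"
  assumes "\<And>v. A (w + v) \<longleftrightarrow> B v"
  shows "filter_words A (Poly_Mapping.single w c * q) = Poly_Mapping.single w c * filter_words B q"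
  by (induction q rule: ncpoly_induct)
    (simp_all add: mult_single filter_words_single assms filter_words_add ring_distribs)

lemma filter_words_mult_single_right:
  fixes q :: "('x, 'k::field) ncpoly"
  assumes "\<And>v. A (v + w) \<longleftrightarrow> B v"
  shows "filter_words A (q * Poly_Mapping.single w c) = filter_words B q * Poly_Mapping.single w c"
  by (induction q rule: ncpoly_induct)
    (simp_all add: mult_single filter_words_single assms filter_words_add ring_distribs)

text \<open>
  A set of words described by a condition on single letters is closed under concatenation and
  under taking factors, so deleting all other words is multiplicative. This is what makes
  killing the generators outside a graph a ring homomorphism.
\<close>

lemma filter_words_mult:
  fixes p q :: "('x, 'k::field) ncpoly"
  assumes "\<And>v w. A (v + w) \<longleftrightarrow> A v \<and> A w"
  shows "filter_words A (p * q) = filter_words A p * filter_words A q"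
proof (induction p rule: ncpoly_induct)
  case (single w c)
  show ?case
  proof (cases "A w")
    case True
    then show ?thesis
      using filter_words_mult_single_left[of A w A c q] assms by (simp add: filter_words_single)
  next
    case False
    have "filter_words A (Poly_Mapping.single w c * q) = 0"
      by (induction q rule: ncpoly_induct)
        (simp_all add: mult_single filter_words_single assms False filter_words_add ring_distribs)
    then show ?thesis using False by (simp add: filter_words_single)
  qed
qed (simp_all add: filter_words_add ring_distribs)

abbreviation const_poly :: "'k \<Rightarrow> ('x, 'k::field) ncpoly"
  where "const_poly c \<equiv> Poly_Mapping.single 0 c"

lemma const_poly_commute: "const_poly c * p = p * const_poly c"
  by (induction p rule: ncpoly_induct) (simp_all add: mult_single ring_distribs mult.commute)

lemma single_eq_const_mult: "Poly_Mapping.single w c = const_poly c * Poly_Mapping.single w 1"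
  by (simp add: mult_single)

lemma single_between:
  "a * Poly_Mapping.single w c * b = const_poly c * (a * Poly_Mapping.single w 1 * b)"
  by (subst single_eq_const_mult) (simp only: mult.assoc[symmetric] const_poly_commute[of c a])

lemma const_poly_sum: "(\<Sum>i\<in>S. const_poly (f i)) = const_poly (\<Sum>i\<in>S. f i)"
  by (induction S rule: infinite_finite_induct) (simp_all add: single_add)

lemma single_Cons: "Poly_Mapping.single (Word (g # gs)) 1 = gen g * Poly_Mapping.single (Word gs) 1"
  by (simp add: gen_def mult_single plus_free_word_def)

lemma word_degree_simps [simp]:
  "word_degree (Word []) = 0" "word_degree (Word (g # gs)) = gen_degree g + word_degree (Word gs)"
  "word_degree (a + b) = word_degree a + word_degree b" "word_degree 0 = 0"
  by (simp_all add: word_degree_def plus_free_word_def zero_free_word_def)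

lemma abs_word_degree_le: "\<bar>word_degree w\<bar> \<le> int (length (letters w))"
proof -
  have "\<bar>sum_list (map gen_degree gs)\<bar> \<le> int (length gs)" for gs :: "('a, 'b) lpa_gen list"
  proof (induction gs)
    case (Cons g gs)
    have "\<bar>gen_degree g\<bar> \<le> 1" by (cases g) auto
    with Cons show ?case by auto
  qed simp
  then show ?thesis by (simp add: word_degree_def)
qed

abbreviation homogeneous_part :: "int \<Rightarrow> ('v, 'e, 'k::field) lpa_poly \<Rightarrow> ('v, 'e, 'k) lpa_poly"
  where "homogeneous_part n \<equiv> filter_words (\<lambda>w. word_degree w = n)"

lemma homogeneous_part_mult_left:
  fixes a p :: "('v, 'e, 'k::field) lpa_poly"
  assumes "\<And>w. w \<in> Poly_Mapping.keys a \<Longrightarrow> word_degree w = d"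
  shows "homogeneous_part n (a * p) = a * homogeneous_part (n - d) p"
proof -
  let ?s = "\<lambda>w. Poly_Mapping.single w (Poly_Mapping.lookup a w)"
  have "homogeneous_part n (a * p) = (\<Sum>w\<in>Poly_Mapping.keys a. homogeneous_part n (?s w * p))"
    by (subst ncpoly_decomp[of a]) (simp add: sum_distrib_right filter_words_sum)
  also have "\<dots> = (\<Sum>w\<in>Poly_Mapping.keys a. ?s w * homogeneous_part (n - d) p)"
    using assms by (intro sum.cong refl filter_words_mult_single_left) auto
  also have "\<dots> = a * homogeneous_part (n - d) p"
    by (subst (3) ncpoly_decomp[of a]) (simp add: sum_distrib_right)
  finally show ?thesis .
qed

lemma ncpoly_sum_homogeneous_parts:
  assumes "finite N" "word_degree ` Poly_Mapping.keys p \<subseteq> N"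
  shows "p = (\<Sum>n\<in>N. homogeneous_part n p)"
proof (rule poly_mapping_eqI)
  fix w
  have "(\<Sum>n\<in>N. if word_degree w = n then Poly_Mapping.lookup p w else 0) =
      (if word_degree w \<in> N then Poly_Mapping.lookup p w else 0)"
    using assms(1) by simp
  then show "Poly_Mapping.lookup p w = Poly_Mapping.lookup (\<Sum>n\<in>N. homogeneous_part n p) w"
    using assms(2) by (cases "w \<in> Poly_Mapping.keys p") (auto simp: lookup_sum in_keys_iff)
qed

section \<open>Congruences on the Leavitt path algebra\<close>

abbreviation vert_poly :: "'v \<Rightarrow> ('v, 'e, 'k::field) lpa_poly" where "vert_poly v \<equiv> gen (Vertex v)"
abbreviation edge_poly :: "'e \<Rightarrow> ('v, 'e, 'k::field) lpa_poly" where "edge_poly e \<equiv> gen (Edge e)"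
abbreviation ghost_poly :: "'e \<Rightarrow> ('v, 'e, 'k::field) lpa_poly" where "ghost_poly e \<equiv> gen (Ghost e)"

text \<open>
  The preimage of an ideal of $L_K(E)$ under the projection from the free unital algebra on all
  generators. The last two conditions express that generators foreign to the graph are
  killed and that the sum of the vertices is the identity, so that no carrier conditions are left.
\<close>

locale lpa_congruence = fin_digraph E
  for E :: "('v, 'e) pre_digraph" (structure) +
  fixes Q :: "('v, 'e, 'k::field) lpa_poly set"
  assumes zero_mem: "0 \<in> Q"
    and add_mem: "p \<in> Q \<Longrightarrow> q \<in> Q \<Longrightarrow> p + q \<in> Q"
    and mult_mem_left: "p \<in> Q \<Longrightarrow> a * p \<in> Q"
    and mult_mem_right: "p \<in> Q \<Longrightarrow> p * a \<in> Q"
    and relations_mem: "lpa_relations E \<subseteq> Q"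
    and outside_mem: "g \<notin> lpa_gens E \<Longrightarrow> gen g \<in> Q"
    and unit_mem: "1 - (\<Sum>v\<in>verts E. vert_poly v) \<in> Q"
begin

definition cong :: "('v, 'e, 'k) lpa_poly \<Rightarrow> ('v, 'e, 'k) lpa_poly \<Rightarrow> bool" (infix \<open>\<approx>\<close> 50)
  where "p \<approx> q \<longleftrightarrow> p - q \<in> Q"

lemma uminus_mem: "p \<in> Q \<Longrightarrow> - p \<in> Q"
  using mult_mem_left[of p "-1"] by simp

lemma diff_mem: "p \<in> Q \<Longrightarrow> q \<in> Q \<Longrightarrow> p - q \<in> Q"
  using add_mem[of p "- q"] uminus_mem[of q] by simp

lemma sum_mem: "(\<And>i. i \<in> I \<Longrightarrow> f i \<in> Q) \<Longrightarrow> sum f I \<in> Q"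
  by (induction I rule: infinite_finite_induct) (auto intro: zero_mem add_mem)

lemma cong_refl [simp, intro]: "p \<approx> p"
  by (simp add: cong_def zero_mem)

lemma cong_sym: "p \<approx> q \<Longrightarrow> q \<approx> p"
  using uminus_mem[of "p - q"] by (simp add: cong_def)

lemma cong_trans [trans]: "p \<approx> q \<Longrightarrow> q \<approx> r \<Longrightarrow> p \<approx> r"
  using add_mem[of "p - q" "q - r"] by (simp add: cong_def)

lemma cong_zero_iff: "p \<approx> 0 \<longleftrightarrow> p \<in> Q"
  by (simp add: cong_def)

lemma cong_mem_iff: "p \<approx> q \<Longrightarrow> p \<in> Q \<longleftrightarrow> q \<in> Q"
  using cong_trans cong_sym cong_zero_iff by blast

lemma cong_mult_left: "p \<approx> q \<Longrightarrow> a * p \<approx> a * q"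
  using mult_mem_left[of "p - q" a] by (simp add: cong_def right_diff_distrib)

lemma cong_mult_right: "p \<approx> q \<Longrightarrow> p * a \<approx> q * a"
  using mult_mem_right[of "p - q" a] by (simp add: cong_def left_diff_distrib)

lemma cong_mult: "p \<approx> q \<Longrightarrow> a \<approx> b \<Longrightarrow> p * a \<approx> q * b"
  by (blast intro: cong_trans cong_mult_left cong_mult_right)

lemma cong_add: "p \<approx> q \<Longrightarrow> a \<approx> b \<Longrightarrow> p + a \<approx> q + b"
  using add_mem[of "p - q" "a - b"] by (simp add: cong_def algebra_simps)

lemma cong_diff: "p \<approx> q \<Longrightarrow> a \<approx> b \<Longrightarrow> p - a \<approx> q - b"
  using diff_mem[of "p - q" "a - b"] by (simp add: cong_def algebra_simps)

lemma cong_sum: "(\<And>i. i \<in> I \<Longrightarrow> f i \<approx> g i) \<Longrightarrow> sum f I \<approx> sum g I"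
  using sum_mem[of I "\<lambda>i. f i - g i"] by (simp add: cong_def sum_subtractf)

lemma const_mem_iff:
  assumes "c \<noteq> 0"
  shows "const_poly c * p \<in> Q \<longleftrightarrow> p \<in> Q"
proof
  assume "const_poly c * p \<in> Q"
  then have "const_poly (inverse c) * (const_poly c * p) \<in> Q" by (rule mult_mem_left)
  then show "p \<in> Q" using assms by (simp add: mult.assoc[symmetric] mult_single)
qed (rule mult_mem_left)

lemma outside_vertex: "v \<notin> verts E \<Longrightarrow> vert_poly v \<in> Q"
  and outside_edge: "e \<notin> arcs E \<Longrightarrow> edge_poly e \<in> Q"
  and outside_ghost: "e \<notin> arcs E \<Longrightarrow> ghost_poly e \<in> Q"
  by (rule outside_mem; auto simp: lpa_gens_def)+

lemma vert_idem: "vert_poly v * vert_poly v \<approx> vert_poly v"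
proof (cases "v \<in> verts E")
  case True
  then have "vert_poly v * vert_poly v - vert_poly v \<in> (lpa_relations E :: ('v, 'e, 'k) lpa_poly set)"
    by (auto simp: lpa_relations_def)
  then show ?thesis using relations_mem by (auto simp: cong_def)
next
  case False
  then show ?thesis by (auto simp: cong_def intro!: diff_mem mult_mem_left outside_vertex)
qed

lemma vert_orth: "v \<noteq> w \<Longrightarrow> vert_poly v * vert_poly w \<in> Q"
proof (cases "v \<in> verts E \<and> w \<in> verts E")
  case True
  assume "v \<noteq> w"
  then have "vert_poly v * vert_poly w \<in> (lpa_relations E :: ('v, 'e, 'k) lpa_poly set)"
    using True by (auto simp: lpa_relations_def)
  then show ?thesis using relations_mem by auto
qed (auto intro: mult_mem_left mult_mem_right outside_vertex)

lemma tail_edge: "e \<in> arcs E \<Longrightarrow> vert_poly (tail E e) * edge_poly e \<approx> edge_poly e"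
  and edge_head: "e \<in> arcs E \<Longrightarrow> edge_poly e * vert_poly (head E e) \<approx> edge_poly e"
  and head_ghost: "e \<in> arcs E \<Longrightarrow> vert_poly (head E e) * ghost_poly e \<approx> ghost_poly e"
  and ghost_tail: "e \<in> arcs E \<Longrightarrow> ghost_poly e * vert_poly (tail E e) \<approx> ghost_poly e"
  and ghost_edge: "e \<in> arcs E \<Longrightarrow> ghost_poly e * edge_poly e \<approx> vert_poly (head E e)"
  unfolding cong_def by (rule subsetD[OF relations_mem], auto simp: lpa_relations_def)+

lemma ghost_edge_orth: "e \<noteq> f \<Longrightarrow> ghost_poly e * edge_poly f \<in> Q"
proof (cases "e \<in> arcs E \<and> f \<in> arcs E")
  case True
  assume "e \<noteq> f"
  then have "ghost_poly e * edge_poly f \<in> (lpa_relations E :: ('v, 'e, 'k) lpa_poly set)"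
    using True by (auto simp: lpa_relations_def)
  then show ?thesis using relations_mem by auto
qed (auto intro: mult_mem_left mult_mem_right outside_edge outside_ghost)

lemma regular_expand:
  assumes "v \<in> verts E" "out_arcs E v \<noteq> {}"
  shows "vert_poly v \<approx> (\<Sum>e\<in>out_arcs E v. edge_poly e * ghost_poly e)"
proof -
  have "regular_vertex E v" using assms by (auto simp: regular_vertex_def)
  then have "vert_poly v - (\<Sum>e\<in>out_arcs E v. edge_poly e * ghost_poly e) \<in>
      (lpa_relations E :: ('v, 'e, 'k) lpa_poly set)"
    unfolding lpa_relations_def by (intro UnI2) blast
  then show ?thesis using relations_mem by (auto simp: cong_def)
qed

lemma vert_edge_orth:
  assumes "v \<noteq> tail E e" shows "vert_poly v * edge_poly e \<in> Q"
proof (cases "e \<in> arcs E")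
  case True
  have "vert_poly v * edge_poly e \<approx> vert_poly v * (vert_poly (tail E e) * edge_poly e)"
    using True by (intro cong_mult_left cong_sym[OF tail_edge])
  moreover have "vert_poly v * (vert_poly (tail E e) * edge_poly e) \<in> Q"
    using mult_mem_right[OF vert_orth[OF assms]] by (simp add: mult.assoc)
  ultimately show ?thesis by (simp add: cong_mem_iff)
qed (intro mult_mem_left outside_edge)

lemma ghost_vert_orth:
  assumes "v \<noteq> tail E e" shows "ghost_poly e * vert_poly v \<in> Q"
proof (cases "e \<in> arcs E")
  case True
  have "ghost_poly e * vert_poly v \<approx> (ghost_poly e * vert_poly (tail E e)) * vert_poly v"
    using True by (intro cong_mult_right cong_sym[OF ghost_tail])
  moreover have "(ghost_poly e * vert_poly (tail E e)) * vert_poly v \<in> Q"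
    using mult_mem_left[OF vert_orth[OF assms[symmetric]]] by (simp add: mult.assoc)
  ultimately show ?thesis by (simp add: cong_mem_iff)
qed (intro mult_mem_right outside_ghost)

lemma edge_vert_orth:
  assumes "v \<noteq> head E e" shows "edge_poly e * vert_poly v \<in> Q"
proof (cases "e \<in> arcs E")
  case True
  have "edge_poly e * vert_poly v \<approx> (edge_poly e * vert_poly (head E e)) * vert_poly v"
    using True by (intro cong_mult_right cong_sym[OF edge_head])
  moreover have "(edge_poly e * vert_poly (head E e)) * vert_poly v \<in> Q"
    using mult_mem_left[OF vert_orth[OF assms[symmetric]]] by (simp add: mult.assoc)
  ultimately show ?thesis by (simp add: cong_mem_iff)
qed (intro mult_mem_right outside_edge)

text \<open>
  The vertices form a complete system of idempotents, so membership can be tested on each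
  Peirce component.
\<close>

lemma mem_if_vertices_right: "(\<And>v. v \<in> verts E \<Longrightarrow> p * vert_poly v \<in> Q) \<Longrightarrow> p \<in> Q"
proof -
  assume *: "\<And>v. v \<in> verts E \<Longrightarrow> p * vert_poly v \<in> Q"
  have "p = p * (1 - (\<Sum>v\<in>verts E. vert_poly v)) + (\<Sum>v\<in>verts E. p * vert_poly v)"
    by (simp add: algebra_simps sum_distrib_left)
  also have "\<dots> \<in> Q" by (intro add_mem mult_mem_left unit_mem sum_mem *)
  finally show ?thesis .
qed

lemma mem_if_vertices_left: "(\<And>v. v \<in> verts E \<Longrightarrow> vert_poly v * p \<in> Q) \<Longrightarrow> p \<in> Q"
proof -
  assume *: "\<And>v. v \<in> verts E \<Longrightarrow> vert_poly v * p \<in> Q"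
  have "p = (1 - (\<Sum>v\<in>verts E. vert_poly v)) * p + (\<Sum>v\<in>verts E. vert_poly v * p)"
    by (simp add: algebra_simps sum_distrib_right)
  also have "\<dots> \<in> Q" by (intro add_mem mult_mem_right unit_mem sum_mem *)
  finally show ?thesis .
qed

section \<open>Words acting on paths\<close>

text \<open>
  The range is kept as a separate argument because a path of length zero does not determine it;
  ending with the vertex \<open>x\<close> also makes every path end in an idempotent.
\<close>

fun path_poly :: "'e list \<Rightarrow> 'v \<Rightarrow> ('v, 'e, 'k) lpa_poly" where
  "path_poly [] x = vert_poly x"
| "path_poly (e # \<mu>) x = edge_poly e * path_poly \<mu> x"

fun ghost_path_poly :: "'e list \<Rightarrow> 'v \<Rightarrow> ('v, 'e, 'k) lpa_poly" where
  "ghost_path_poly [] x = vert_poly x"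
| "ghost_path_poly (e # \<mu>) x = ghost_path_poly \<mu> x * ghost_poly e"

lemma source_path:
  assumes "awalk s \<mu> x"
  shows "vert_poly s * path_poly \<mu> x \<approx> path_poly \<mu> x"
proof (cases \<mu>)
  case (Cons e \<nu>)
  then have e: "e \<in> arcs E" "s = tail E e" using assms by (auto simp: awalk_Cons_iff)
  show ?thesis
    using cong_mult_right[OF tail_edge[OF e(1)], of "path_poly \<nu> x"] Cons e(2)
    by (simp add: mult.assoc)
qed (use assms vert_idem in \<open>auto simp: awalk_Nil_iff\<close>)

lemma ghost_path_source:
  assumes "awalk s \<mu> x"
  shows "ghost_path_poly \<mu> x * vert_poly s \<approx> ghost_path_poly \<mu> x"
proof (cases \<mu>)
  case (Cons e \<nu>)
  then have e: "e \<in> arcs E" "s = tail E e" using assms by (auto simp: awalk_Cons_iff)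
  show ?thesis
    using cong_mult_left[OF ghost_tail[OF e(1)], of "ghost_path_poly \<nu> x"] Cons e(2)
    by (simp add: mult.assoc)
qed (use assms vert_idem in \<open>auto simp: awalk_Nil_iff\<close>)

lemma source_path_orth:
  assumes "awalk s \<mu> x" "v \<noteq> s"
  shows "vert_poly v * path_poly \<mu> x \<in> Q"
proof -
  have "vert_poly v * path_poly \<mu> x \<approx> vert_poly v * (vert_poly s * path_poly \<mu> x)"
    using assms by (intro cong_mult_left cong_sym[OF source_path])
  moreover have "vert_poly v * (vert_poly s * path_poly \<mu> x) \<in> Q"
    using mult_mem_right[OF vert_orth[OF assms(2)]] by (simp add: mult.assoc)
  ultimately show ?thesis by (simp add: cong_mem_iff)
qed

lemma path_poly_range: "path_poly \<mu> x * vert_poly x \<approx> path_poly \<mu> x"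
  by (induction \<mu>) (auto simp: mult.assoc intro: vert_idem cong_mult_left)

lemma path_mem: "vert_poly x \<in> Q \<Longrightarrow> path_poly \<mu> x \<in> Q"
  by (induction \<mu>) (auto intro: mult_mem_left)

lemma path_snoc:
  assumes "e \<in> arcs E" "tail E e = x"
  shows "path_poly (\<mu> @ [e]) (head E e) \<approx> path_poly \<mu> x * edge_poly e"
proof (induction \<mu>)
  case Nil
  show ?case
    using cong_trans[OF edge_head[OF assms(1)] cong_sym[OF tail_edge[OF assms(1)]]] assms(2) by simp
next
  case (Cons f \<mu>)
  then show ?case by (simp add: cong_mult_left mult.assoc)
qed

lemma ghost_path_path:
  assumes "awalk s \<mu> x"
  shows "ghost_path_poly \<mu> x * path_poly \<mu> x \<approx> vert_poly x"
  using assms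
proof (induction \<mu> arbitrary: s)
  case Nil
  show ?case using vert_idem by simp
next
  case (Cons e \<mu>)
  then have e: "e \<in> arcs E" and w: "awalk (head E e) \<mu> x" by (auto simp: awalk_Cons_iff)
  have "ghost_path_poly (e # \<mu>) x * path_poly (e # \<mu>) x =
      ghost_path_poly \<mu> x * (ghost_poly e * edge_poly e) * path_poly \<mu> x"
    by (simp add: mult.assoc)
  also have "\<dots> \<approx> ghost_path_poly \<mu> x * vert_poly (head E e) * path_poly \<mu> x"
    using e by (intro cong_mult_left cong_mult_right ghost_edge)
  also have "\<dots> \<approx> ghost_path_poly \<mu> x * path_poly \<mu> x"
    using w by (intro cong_mult_right ghost_path_source)
  also have "\<dots> \<approx> vert_poly x" by (rule Cons.IH[OF w])
  finally show ?case .
qed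

text \<open>
  Reading $\mu^*\nu$ from the inside out cancels the common prefix. If neither path is an initial
  segment of the other, this ends in some $e^* f$ with \<open>e \<noteq> f\<close> or in a product
  of distinct vertices. A shorter path ending in a sink is
  never a proper initial segment, which is why the two length conditions exclude the
  remaining cases.
\<close>

lemma ghost_path_path_orth:
  assumes "awalk s \<mu> x" "awalk t \<nu> y" "(\<mu>, x) \<noteq> (\<nu>, y)"
    "length \<mu> < length \<nu> \<Longrightarrow> out_arcs E x = {}" "length \<nu> < length \<mu> \<Longrightarrow> out_arcs E y = {}"
  shows "ghost_path_poly \<mu> x * path_poly \<nu> y \<in> Q"
  using assms
proof (induction \<mu> arbitrary: s t \<nu>)
  case Nil
  show ?case
  proof (cases \<nu>)
    case Nil
    then show ?thesis using Nil.prems(3) by (auto intro: vert_orth)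
  next
    case (Cons f \<nu>')
    with Nil.prems have "x \<noteq> tail E f" by (auto simp: awalk_Cons_iff)
    then show ?thesis
      using Cons mult_mem_right[OF vert_edge_orth[of x f], of "path_poly \<nu>' y"]
      by (simp add: mult.assoc)
  qed
next
  case (Cons e \<mu>)
  then have e: "e \<in> arcs E" and w: "awalk (head E e) \<mu> x" by (auto simp: awalk_Cons_iff)
  show ?case
  proof (cases \<nu>)
    case Nil
    with Cons.prems e have "y \<noteq> tail E e" by auto
    then show ?thesis
      using Nil mult_mem_left[OF ghost_vert_orth[of y e], of "ghost_path_poly \<mu> x"]
      by (simp add: mult.assoc)
  next
    case \<nu>: (Cons f \<nu>')
    then have w': "awalk (head E f) \<nu>' y" using Cons.prems by (auto simp: awalk_Cons_iff)
    have eq: "ghost_path_poly (e # \<mu>) x * path_poly \<nu> y =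
        ghost_path_poly \<mu> x * (ghost_poly e * edge_poly f) * path_poly \<nu>' y"
      by (simp add: \<nu> mult.assoc)
    show ?thesis
    proof (cases "e = f")
      case False
      then show ?thesis unfolding eq by (intro mult_mem_left mult_mem_right ghost_edge_orth)
    next
      case True
      have "ghost_path_poly (e # \<mu>) x * path_poly \<nu> y \<approx>
          ghost_path_poly \<mu> x * vert_poly (head E e) * path_poly \<nu>' y"
        unfolding eq using True e by (auto intro!: cong_mult_left cong_mult_right ghost_edge)
      also have "\<dots> \<approx> ghost_path_poly \<mu> x * path_poly \<nu>' y"
        using w by (intro cong_mult_right ghost_path_source)
      finally show ?thesis
        using Cons.IH[OF w w'] Cons.prems(3-5) True \<nu> by (simp add: cong_mem_iff)
    qed
  qed
qed

text \<open>
  A vertex tests the source of a path, an edge extends the path, and a ghost edge strips its first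
  edge. Only stripping from a path of length zero could leave the set of paths, and that is
  harmless when the path sits at a sink, since a ghost edge kills a sink.
\<close>

lemma gen_on_path:
  assumes w: "awalk s \<nu> x" and long: "\<nu> \<noteq> [] \<or> out_arcs E x = {}"
  shows "gen g * path_poly \<nu> x \<in> Q \<or> (\<exists>t \<nu>'. awalk t \<nu>' x \<and>
      int (length \<nu>') = int (length \<nu>) + gen_degree g \<and> gen g * path_poly \<nu> x \<approx> path_poly \<nu>' x)"
proof (cases g)
  case (Vertex v)
  show ?thesis
  proof (cases "v = s")
    case True
    then show ?thesis using source_path[OF w] w Vertex by auto
  next
    case False
    then show ?thesis using source_path_orth[OF w] Vertex by blast
  qed
next
  case (Edge e)
  show ?thesis
  proof (cases "e \<in> arcs E \<and> head E e = s")
    case True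
    then have "awalk (tail E e) (e # \<nu>) x" using w by (auto simp: awalk_Cons_iff)
    then show ?thesis using Edge by (intro disjI2 exI[of _ "tail E e"] exI[of _ "e # \<nu>"]) auto
  next
    case False
    have "edge_poly e * path_poly \<nu> x \<in> Q"
    proof (cases "e \<in> arcs E")
      case True
      have "edge_poly e * path_poly \<nu> x \<approx> edge_poly e * (vert_poly s * path_poly \<nu> x)"
        using w by (intro cong_mult_left cong_sym[OF source_path])
      moreover have "edge_poly e * (vert_poly s * path_poly \<nu> x) \<in> Q"
        using mult_mem_right[OF edge_vert_orth[of s e]] False True by (auto simp: mult.assoc)
      ultimately show ?thesis by (simp add: cong_mem_iff)
    qed (intro mult_mem_right outside_edge)
    then show ?thesis using Edge by simp
  qed
next
  case (Ghost f)
  show ?thesis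
  proof (cases \<nu>)
    case Nil
    then have x: "out_arcs E x = {}" using long by simp
    have "ghost_poly f * vert_poly x \<in> Q"
    proof (cases "f \<in> arcs E")
      case True
      then have "x \<noteq> tail E f" using x by auto
      then show ?thesis by (rule ghost_vert_orth)
    qed (intro mult_mem_right outside_ghost)
    then show ?thesis using Ghost Nil by simp
  next
    case (Cons e \<nu>')
    then have e: "e \<in> arcs E" and w': "awalk (head E e) \<nu>' x" using w by (auto simp: awalk_Cons_iff)
    have eq: "gen g * path_poly \<nu> x = (ghost_poly f * edge_poly e) * path_poly \<nu>' x"
      by (simp add: Ghost Cons mult.assoc)
    show ?thesis
    proof (cases "f = e")
      case True
      have "gen g * path_poly \<nu> x \<approx> vert_poly (head E e) * path_poly \<nu>' x"
        unfolding eq True by (intro cong_mult_right ghost_edge e)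
      also have "\<dots> \<approx> path_poly \<nu>' x" by (rule source_path[OF w'])
      finally show ?thesis using w' Cons Ghost by auto
    next
      case False
      then show ?thesis unfolding eq by (intro disjI1 mult_mem_right ghost_edge_orth)
    qed
  qed
qed

text \<open>
  Each letter shortens the path by at most one edge, so a path that is as long as the word never
  runs out before the last letter has acted.
\<close>

lemma word_on_path:
  assumes "awalk s \<nu> x" "length (letters w) \<le> length \<nu> \<or> out_arcs E x = {}"
  shows "Poly_Mapping.single w 1 * path_poly \<nu> x \<in> Q \<or> (\<exists>t \<nu>'. awalk t \<nu>' x \<and>
      int (length \<nu>') = int (length \<nu>) + word_degree w \<and>
      Poly_Mapping.single w 1 * path_poly \<nu> x \<approx> path_poly \<nu>' x)"
proof -
  have "Poly_Mapping.single (Word gs) 1 * path_poly \<nu> x \<in> Q \<or> (\<exists>t \<nu>'. awalk t \<nu>' x \<and>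
      int (length \<nu>') = int (length \<nu>) + word_degree (Word gs) \<and>
      Poly_Mapping.single (Word gs) 1 * path_poly \<nu> x \<approx> path_poly \<nu>' x)"
    if "length gs \<le> length \<nu> \<or> out_arcs E x = {}" for gs
    using that
  proof (induction gs)
    case Nil
    have "Poly_Mapping.single (Word []) 1 = (1 :: ('v, 'e, 'k) lpa_poly)"
      by (simp add: zero_free_word_def[symmetric])
    then show ?case using assms(1) by auto
  next
    case (Cons g gs)
    let ?W = "Poly_Mapping.single (Word gs) 1 :: ('v, 'e, 'k) lpa_poly"
    have eq: "Poly_Mapping.single (Word (g # gs)) 1 * path_poly \<nu> x = gen g * (?W * path_poly \<nu> x)"
      unfolding single_Cons by (simp add: mult.assoc)
    from Cons.prems have "length gs \<le> length \<nu> \<or> out_arcs E x = {}" by auto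
    from Cons.IH[OF this] show ?case
    proof (elim disjE exE conjE)
      assume "?W * path_poly \<nu> x \<in> Q"
      then show ?thesis unfolding eq by (intro disjI1) (rule mult_mem_left)
    next
      fix t \<nu>'
      assume \<nu>': "awalk t \<nu>' x" "int (length \<nu>') = int (length \<nu>) + word_degree (Word gs)"
        and red: "?W * path_poly \<nu> x \<approx> path_poly \<nu>' x"
      have "\<nu>' \<noteq> [] \<or> out_arcs E x = {}"
        using Cons.prems \<nu>'(2) abs_word_degree_le[of "Word gs"] by auto
      note step = cong_mult_left[OF red, of "gen g"]
      from gen_on_path[OF \<nu>'(1) \<open>\<nu>' \<noteq> [] \<or> out_arcs E x = {}\<close>, of g] show ?thesis
      proof (elim disjE exE conjE)
        assume "gen g * path_poly \<nu>' x \<in> Q"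
        then show ?thesis using cong_mem_iff[OF step] by (simp add: eq)
      next
        fix t' \<nu>''
        assume *: "awalk t' \<nu>'' x" "int (length \<nu>'') = int (length \<nu>') + gen_degree g"
          "gen g * path_poly \<nu>' x \<approx> path_poly \<nu>'' x"
        show ?thesis
          using *(1,2) \<nu>'(2) cong_trans[OF step *(3)]
          by (intro disjI2 exI[of _ t'] exI[of _ \<nu>'']) (simp add: eq)
      qed
    qed
  qed
  from this[of "letters w"] assms(2) show ?thesis by simp
qed

text \<open>
  The paths that remain after expanding \<open>v\<close> by $w = \sum ee^*$ as often as possible, but at most
  \<open>N\<close> times.
\<close>

definition maximal_paths :: "nat \<Rightarrow> 'v \<Rightarrow> ('e list \<times> 'v) set" where
  "maximal_paths N v = {(\<nu>, x). awalk v \<nu> x \<and>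
     (length \<nu> = N \<or> length \<nu> < N \<and> out_arcs E x = {})}"

lemma maximal_paths_0: "v \<in> verts E \<Longrightarrow> maximal_paths 0 v = {([], v)}"
  by (auto simp: maximal_paths_def awalk_Nil_iff)

lemma maximal_paths_sink:
  "v \<in> verts E \<Longrightarrow> out_arcs E v = {} \<Longrightarrow> ([], v) \<in> maximal_paths N v"
  by (cases N) (auto simp: maximal_paths_def awalk_Nil_iff)

lemma maximal_paths_Cons:
  "e \<in> arcs E \<Longrightarrow> (\<nu>, x) \<in> maximal_paths N (head E e) \<Longrightarrow> (e # \<nu>, x) \<in> maximal_paths (Suc N) (tail E e)"
  by (auto simp: maximal_paths_def awalk_Cons_iff)

text \<open>
  The elements $\nu\nu^*$ for maximal \<open>\<nu>\<close> sum up to \<open>v\<close> modulo \<open>Q\<close>; induction on \<open>N\<close> avoids writing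
  this sum down.
\<close>

lemma mem_if_paths_right:
  assumes "v \<in> verts E" "\<And>\<nu> x. (\<nu>, x) \<in> maximal_paths N v \<Longrightarrow> p * path_poly \<nu> x \<in> Q"
  shows "p * vert_poly v \<in> Q"
  using assms
proof (induction N arbitrary: v p)
  case 0
  then show ?case by (auto simp: maximal_paths_0)
next
  case (Suc N)
  show ?case
  proof (cases "out_arcs E v = {}")
    case True
    with Suc.prems(2)[OF maximal_paths_sink] Suc.prems(1) show ?thesis by simp
  next
    case False
    have "p * (\<Sum>e\<in>out_arcs E v. edge_poly e * ghost_poly e) \<in> Q"
      unfolding sum_distrib_left
    proof (rule sum_mem)
      fix e assume "e \<in> out_arcs E v"
      then have e: "e \<in> arcs E" "tail E e = v" by auto
      have "p * edge_poly e * vert_poly (head E e) \<in> Q"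
      proof (rule Suc.IH)
        fix \<nu> x assume "(\<nu>, x) \<in> maximal_paths N (head E e)"
        from Suc.prems(2)[OF maximal_paths_Cons[OF e(1) this, unfolded e(2)]]
        show "p * edge_poly e * path_poly \<nu> x \<in> Q" by (simp add: mult.assoc)
      qed (use e in simp)
      then have "p * edge_poly e \<in> Q"
        using cong_mem_iff[OF cong_mult_left[OF edge_head[OF e(1)], of p]] by (simp add: mult.assoc)
      from mult_mem_right[OF this, of "ghost_poly e"]
      show "p * (edge_poly e * ghost_poly e) \<in> Q" by (simp add: mult.assoc)
    qed
    then show ?thesis
      using cong_mem_iff[OF cong_mult_left[OF regular_expand[OF Suc.prems(1) False], of p]] by simp
  qed
qed

lemma mem_if_paths_left:
  assumes "v \<in> verts E" "\<And>\<nu> x. (\<nu>, x) \<in> maximal_paths N v \<Longrightarrow> ghost_path_poly \<nu> x * p \<in> Q"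
  shows "vert_poly v * p \<in> Q"
  using assms
proof (induction N arbitrary: v p)
  case 0
  then show ?case by (auto simp: maximal_paths_0)
next
  case (Suc N)
  show ?case
  proof (cases "out_arcs E v = {}")
    case True
    with Suc.prems(2)[OF maximal_paths_sink] Suc.prems(1) show ?thesis by simp
  next
    case False
    have "(\<Sum>e\<in>out_arcs E v. edge_poly e * ghost_poly e) * p \<in> Q"
      unfolding sum_distrib_right
    proof (rule sum_mem)
      fix e assume "e \<in> out_arcs E v"
      then have e: "e \<in> arcs E" "tail E e = v" by auto
      have "vert_poly (head E e) * (ghost_poly e * p) \<in> Q"
      proof (rule Suc.IH)
        fix \<nu> x assume "(\<nu>, x) \<in> maximal_paths N (head E e)"
        from Suc.prems(2)[OF maximal_paths_Cons[OF e(1) this, unfolded e(2)]]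
        show "ghost_path_poly \<nu> x * (ghost_poly e * p) \<in> Q" by (simp add: mult.assoc)
      qed (use e in simp)
      then have "ghost_poly e * p \<in> Q"
        using cong_mem_iff[OF cong_mult_right[OF head_ghost[OF e(1)], of p]] by (simp add: mult.assoc)
      from mult_mem_left[OF this, of "edge_poly e"]
      show "edge_poly e * ghost_poly e * p \<in> Q" by (simp add: mult.assoc)
    qed
    then show ?thesis
      using cong_mem_iff[OF cong_mult_right[OF regular_expand[OF Suc.prems(1) False], of p]] by simp
  qed
qed

end

section \<open>Graded ideals are determined by their vertices\<close>

context lpa_congruence begin

lemma vertex_mem_reachable:
  assumes "u \<rightarrow>\<^sup>* w" "vert_poly u \<in> Q"
  shows "vert_poly w \<in> Q"
proof -
  obtain \<mu> where \<mu>: "awalk u \<mu> w" using assms(1) reachable_awalk by auto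
  have "vert_poly w \<approx> ghost_path_poly \<mu> w * path_poly \<mu> w"
    by (rule cong_sym[OF ghost_path_path[OF \<mu>]])
  also have "\<dots> \<approx> ghost_path_poly \<mu> w * (vert_poly u * path_poly \<mu> w)"
    by (rule cong_mult_left[OF cong_sym[OF source_path[OF \<mu>]]])
  finally show ?thesis
    using mult_mem_left[OF mult_mem_right[OF assms(2)]] by (simp add: cong_mem_iff)
qed

lemma vertex_mem_regular:
  assumes "v \<in> verts E" "out_arcs E v \<noteq> {}" "\<And>e. e \<in> out_arcs E v \<Longrightarrow> vert_poly (head E e) \<in> Q"
  shows "vert_poly v \<in> Q"
proof -
  have "edge_poly e * ghost_poly e \<in> Q" if "e \<in> out_arcs E v" for e
  proof -
    from that have e: "e \<in> arcs E" by auto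
    have "edge_poly e * vert_poly (head E e) \<in> Q" by (intro mult_mem_left assms(3) that)
    then have "edge_poly e \<in> Q" using cong_mem_iff[OF edge_head[OF e]] by simp
    then show ?thesis by (rule mult_mem_right)
  qed
  then have "(\<Sum>e\<in>out_arcs E v. edge_poly e * ghost_poly e) \<in> Q" by (rule sum_mem)
  then show ?thesis using cong_mem_iff[OF regular_expand[OF assms(1,2)]] by simp
qed

text \<open>
  A word of degree \<open>d\<close> turns \<open>\<nu>\<close> into zero or into a path \<open>\<kappa>\<close> of length \<open>|\<nu>| + d\<close>. Allowing \<open>N + d\<close> for
  the length of \<open>\<mu>\<close> makes \<open>\<mu>\<close> and \<open>\<kappa>\<close> orthogonal unless they coincide, and then $\mu^*\kappa$ is
  the vertex \<open>x\<close>.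
\<close>

lemma ghost_path_homogeneous_path:
  assumes \<mu>: "(\<mu>, y) \<in> maximal_paths (nat (int N + d)) s" and \<nu>: "(\<nu>, x) \<in> maximal_paths N t"
    and p: "\<And>w. w \<in> Poly_Mapping.keys p \<Longrightarrow> word_degree w = d \<and> length (letters w) \<le> N"
  shows "\<exists>c. ghost_path_poly \<mu> y * p * path_poly \<nu> x \<approx> const_poly c * vert_poly x"
proof -
  have "\<exists>c. ghost_path_poly \<mu> y * Poly_Mapping.single w 1 * path_poly \<nu> x \<approx> const_poly c * vert_poly x"
    if "w \<in> Poly_Mapping.keys p" for w
  proof -
    have w: "word_degree w = d" "length (letters w) \<le> N" using p[OF that] by auto
    have len: "length \<mu> = nat (int N + d) \<or> length \<mu> < nat (int N + d) \<and> out_arcs E y = {}"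
        "length \<nu> = N \<or> length \<nu> < N \<and> out_arcs E x = {}"
      and wk: "awalk s \<mu> y" "awalk t \<nu> x"
      using \<mu> \<nu> by (auto simp: maximal_paths_def)
    have "length (letters w) \<le> length \<nu> \<or> out_arcs E x = {}" using len(2) w(2) by auto
    from word_on_path[OF wk(2) this] show ?thesis
    proof (elim disjE exE conjE)
      assume "Poly_Mapping.single w 1 * path_poly \<nu> x \<in> Q"
      then have "ghost_path_poly \<mu> y * Poly_Mapping.single w 1 * path_poly \<nu> x \<in> Q"
        using mult_mem_left by (simp add: mult.assoc)
      then show ?thesis by (intro exI[of _ 0]) (simp add: cong_zero_iff)
    next
      fix u \<kappa>
      assume \<kappa>: "awalk u \<kappa> x" "int (length \<kappa>) = int (length \<nu>) + word_degree w"
        and red: "Poly_Mapping.single w 1 * path_poly \<nu> x \<approx> path_poly \<kappa> x"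
      have red': "ghost_path_poly \<mu> y * Poly_Mapping.single w 1 * path_poly \<nu> x \<approx>
          ghost_path_poly \<mu> y * path_poly \<kappa> x"
        using cong_mult_left[OF red] by (simp add: mult.assoc)
      show ?thesis
      proof (cases "(\<mu>, y) = (\<kappa>, x)")
        case True
        then have "ghost_path_poly \<mu> y * path_poly \<kappa> x \<approx> vert_poly x"
          using ghost_path_path[OF \<kappa>(1)] by simp
        with red' show ?thesis by (intro exI[of _ 1]) (auto intro: cong_trans)
      next
        case False
        have "ghost_path_poly \<mu> y * path_poly \<kappa> x \<in> Q"
          using len \<kappa>(2) w(1) by (intro ghost_path_path_orth[OF wk(1) \<kappa>(1) False]) auto
        with red' show ?thesis
          by (intro exI[of _ 0]) (simp add: cong_zero_iff cong_mem_iff)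
      qed
    qed
  qed
  then obtain c where c: "\<And>w. w \<in> Poly_Mapping.keys p \<Longrightarrow>
      ghost_path_poly \<mu> y * Poly_Mapping.single w 1 * path_poly \<nu> x \<approx> const_poly (c w) * vert_poly x"
    by metis
  let ?l = "Poly_Mapping.lookup p"
  have "ghost_path_poly \<mu> y * p * path_poly \<nu> x =
      (\<Sum>w\<in>Poly_Mapping.keys p.
        const_poly (?l w) * (ghost_path_poly \<mu> y * Poly_Mapping.single w 1 * path_poly \<nu> x))"
    by (subst ncpoly_decomp[of p]) (simp add: sum_distrib_left sum_distrib_right single_between[symmetric])
  also have "\<dots> \<approx> (\<Sum>w\<in>Poly_Mapping.keys p. const_poly (?l w) * (const_poly (c w) * vert_poly x))"
    by (intro cong_sum cong_mult_left c)
  also have "\<dots> = const_poly (\<Sum>w\<in>Poly_Mapping.keys p. ?l w * c w) * vert_poly x"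
    by (simp add: mult.assoc[symmetric] mult_single sum_distrib_right[symmetric] const_poly_sum)
  finally show ?thesis by blast
qed

text \<open>
  Graded uniqueness: by the previous lemma a homogeneous \<open>p\<close> in \<open>Q'\<close> compresses to multiples
  $k x$ of vertices. They lie in \<open>Q'\<close>, so either \<open>k = 0\<close> or \<open>x\<close> is in \<open>Q'\<close>, hence in \<open>Q\<close>; in both cases
  the compressions of \<open>p\<close> lie in \<open>Q\<close>, and long paths detect membership.
\<close>

theorem graded_congruence_le:
  assumes Q': "lpa_congruence E Q'" and sub: "Q \<subseteq> Q'"
    and graded: "\<And>p n. p \<in> Q' \<Longrightarrow> homogeneous_part n p \<in> Q'"
    and vert: "\<And>v. vert_poly v \<in> Q' \<Longrightarrow> vert_poly v \<in> Q"
  shows "Q' \<subseteq> Q"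
proof
  interpret Q': lpa_congruence E Q' by fact
  have hom: "p \<in> Q" if p: "p \<in> Q'" and deg: "\<And>w. w \<in> Poly_Mapping.keys p \<Longrightarrow> word_degree w = d" for p d
  proof -
    obtain N where N: "\<And>w. w \<in> Poly_Mapping.keys p \<Longrightarrow> length (letters w) \<le> N"
      using finite_nat_set_iff_bounded_le[of "(\<lambda>w. length (letters w)) ` Poly_Mapping.keys p"] by auto
    have corner: "ghost_path_poly \<mu> y * p * path_poly \<nu> x \<in> Q"
      if \<mu>\<nu>: "(\<mu>, y) \<in> maximal_paths (nat (int N + d)) s" "(\<nu>, x) \<in> maximal_paths N t"
      for s t \<mu> \<nu> x y
    proof -
      obtain c where c: "ghost_path_poly \<mu> y * p * path_poly \<nu> x \<approx> const_poly c * vert_poly x"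
        using ghost_path_homogeneous_path[OF \<mu>\<nu>] deg N by blast
      have "const_poly c * vert_poly x \<in> Q"
      proof (cases "c = 0")
        case False
        have "ghost_path_poly \<mu> y * p * path_poly \<nu> x \<in> Q'"
          by (intro Q'.mult_mem_left Q'.mult_mem_right p)
        moreover have "Q'.cong (ghost_path_poly \<mu> y * p * path_poly \<nu> x) (const_poly c * vert_poly x)"
          using c sub by (auto simp: cong_def Q'.cong_def)
        ultimately have "const_poly c * vert_poly x \<in> Q'" using Q'.cong_mem_iff by blast
        then show ?thesis using False vert by (simp add: const_mem_iff Q'.const_mem_iff)
      qed (simp add: zero_mem)
      then show ?thesis using cong_mem_iff[OF c] by simp
    qed
    show "p \<in> Q"
    proof (rule mem_if_vertices_right, rule mem_if_paths_right, assumption, rule mem_if_vertices_left,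
        subst mult.assoc[symmetric])
      fix t \<nu> x s
      assume t: "t \<in> verts E" "(\<nu>, x) \<in> maximal_paths N t" and s: "s \<in> verts E"
      show "vert_poly s * p * path_poly \<nu> x \<in> Q"
        using mem_if_paths_left[OF s, of "nat (int N + d)" "p * path_poly \<nu> x"] corner[OF _ t(2)]
        by (simp add: mult.assoc)
    qed
  qed
  fix p assume p: "p \<in> Q'"
  have "p = (\<Sum>n\<in>word_degree ` Poly_Mapping.keys p. homogeneous_part n p)"
    by (rule ncpoly_sum_homogeneous_parts) auto
  also have "\<dots> \<in> Q"
  proof (rule sum_mem)
    fix n
    show "homogeneous_part n p \<in> Q"
      by (rule hom[OF graded[OF p], of n n]) (simp add: keys_filter_words)
  qed
  finally show "p \<in> Q" .
qed

end

section \<open>Primitive congruences\<close>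

text \<open>
  A primitive ideal is the largest two-sided ideal inside a maximal left ideal \<open>\<Lambda>\<close>, the
  annihilator of a nonzero element of the simple module. Working with \<open>\<Lambda>\<close> keeps all
  computations inside the free algebra.
\<close>

locale primitive_lpa_congruence = lpa_congruence +
  fixes \<Lambda> :: "('a, 'b, 'c) lpa_poly set"
  assumes left_add: "p \<in> \<Lambda> \<Longrightarrow> q \<in> \<Lambda> \<Longrightarrow> p + q \<in> \<Lambda>"
    and left_mult: "p \<in> \<Lambda> \<Longrightarrow> a * p \<in> \<Lambda>"
    and one_not_left: "1 \<notin> \<Lambda>"
    and left_maximal: "p \<notin> \<Lambda> \<Longrightarrow> \<exists>a. a * p - 1 \<in> \<Lambda>"
    and mem_iff_left: "p \<in> Q \<longleftrightarrow> (\<forall>a. p * a \<in> \<Lambda>)"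
begin

lemma left_diff: "p \<in> \<Lambda> \<Longrightarrow> q \<in> \<Lambda> \<Longrightarrow> p - q \<in> \<Lambda>"
  using left_add[of p "- q"] left_mult[of q "-1"] by simp

lemma mem_left: "p \<in> Q \<Longrightarrow> p \<in> \<Lambda>"
  using mem_iff_left[of p] by (metis mult.right_neutral)

lemma left_iff: "p - q \<in> \<Lambda> \<Longrightarrow> p \<in> \<Lambda> \<longleftrightarrow> q \<in> \<Lambda>"
  using left_add[of "p - q" q] left_diff[of p "p - q"] by auto

lemma left_iff_cong: "p \<approx> q \<Longrightarrow> p \<in> \<Lambda> \<longleftrightarrow> q \<in> \<Lambda>"
  by (intro left_iff mem_left) (simp add: cong_def)

text \<open>
  In the simple module, the element represented by \<open>p\<close> is nonzero, hence generates everything; the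
  conclusion says that some multiple of it is the element represented by \<open>b\<close>.
\<close>

lemma left_transitive:
  assumes "p \<notin> \<Lambda>"
  obtains a where "b * a * p - b \<in> \<Lambda>"
proof -
  obtain a where "a * p - 1 \<in> \<Lambda>" using left_maximal[OF assms] by blast
  then have "b * (a * p - 1) \<in> \<Lambda>" by (rule left_mult)
  then show ?thesis by (intro that[of a]) (simp add: algebra_simps)
qed

lemma not_mem_product:
  assumes "p \<notin> Q" "q \<notin> Q"
  obtains a where "p * a * q \<notin> Q"
proof -
  obtain a b where a: "p * a \<notin> \<Lambda>" and b: "q * b \<notin> \<Lambda>" using assms by (auto simp: mem_iff_left)
  obtain c where "p * a * c * (q * b) - p * a \<in> \<Lambda>" using left_transitive[OF b] by blast
  then have "p * a * c * (q * b) \<notin> \<Lambda>" using a left_iff by blast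
  then have "p * (a * c) * q * b \<notin> \<Lambda>" by (simp add: mult.assoc)
  then have "p * (a * c) * q \<notin> Q" using mem_iff_left by blast
  then show ?thesis by (rule that)
qed

text \<open>
  Choose a word \<open>w\<close> with $u w v \notin Q$ and a maximal path \<open>\<nu>\<close> from \<open>v\<close> with $u w \nu \notin Q$. Then
  $w \nu$ is a path from \<open>u\<close>, and it ends where \<open>\<nu>\<close> does.
\<close>

lemma common_descendant:
  assumes "vert_poly u \<notin> Q" "vert_poly v \<notin> Q"
  shows "\<exists>x. vert_poly x \<notin> Q \<and> u \<rightarrow>\<^sup>* x \<and> v \<rightarrow>\<^sup>* x"
proof -
  obtain a where a: "vert_poly u * a * vert_poly v \<notin> Q" using not_mem_product[OF assms] .
  have v: "v \<in> verts E" using assms(2) outside_vertex by blast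
  have "\<exists>w. vert_poly u * Poly_Mapping.single w 1 * vert_poly v \<notin> Q"
  proof (rule ccontr)
    assume *: "\<not> ?thesis"
    have "vert_poly u * b * vert_poly v \<in> Q" for b
    proof (induction b rule: ncpoly_induct)
      case (single w c)
      show ?case using * by (subst single_between) (simp add: mult_mem_left)
    qed (simp_all add: ring_distribs add_mem zero_mem)
    with a show False by blast
  qed
  then obtain w where w: "vert_poly u * Poly_Mapping.single w 1 * vert_poly v \<notin> Q" by blast
  let ?W = "Poly_Mapping.single w 1 :: ('a, 'b, 'c) lpa_poly"
  obtain \<nu> x where \<nu>: "(\<nu>, x) \<in> maximal_paths (length (letters w)) v"
      and nz: "vert_poly u * ?W * path_poly \<nu> x \<notin> Q"
    using mem_if_paths_right[OF v] w by blast
  from \<nu> have wk: "awalk v \<nu> x" and long: "length (letters w) \<le> length \<nu> \<or> out_arcs E x = {}"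
    by (auto simp: maximal_paths_def)
  have "?W * path_poly \<nu> x \<notin> Q" using nz mult_mem_left[of "?W * path_poly \<nu> x" "vert_poly u"]
    by (auto simp: mult.assoc)
  then obtain t \<nu>' where t: "awalk t \<nu>' x" "?W * path_poly \<nu> x \<approx> path_poly \<nu>' x"
    using word_on_path[OF wk long] by blast
  have nz': "vert_poly u * path_poly \<nu>' x \<notin> Q"
    using nz cong_mem_iff[OF cong_mult_left[OF t(2), of "vert_poly u"]] by (simp add: mult.assoc)
  then have "t = u" using source_path_orth[OF t(1), of u] by auto
  then have "u \<rightarrow>\<^sup>* x" "v \<rightarrow>\<^sup>* x" using t(1) wk reachable_awalkI by blast+
  moreover have "vert_poly x \<notin> Q" using nz' path_mem mult_mem_left by blast
  ultimately show ?thesis by blast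
qed

lemma vertex_not_mem: "\<exists>v\<in>verts E. vert_poly v \<notin> Q"
proof (rule ccontr)
  assume "\<not> ?thesis"
  then have "1 \<in> Q" using mem_if_vertices_right[of 1] by simp
  then show False using mem_left one_not_left by blast
qed

end

section \<open>Cycles without exits\<close>

lemma (in lpa_congruence) path_poly_eq_single:
  "path_poly \<mu> x = Poly_Mapping.single (Word (map Edge \<mu> @ [Vertex x])) 1"
  by (induction \<mu>) (simp_all add: gen_def mult_single plus_free_word_def)

lemma (in lpa_congruence) keys_path_poly_degree:
  "w \<in> Poly_Mapping.keys (path_poly \<mu> x) \<Longrightarrow> word_degree w = int (length \<mu>)"
proof -
  have "sum_list (map (gen_degree \<circ> Edge) \<mu>) = int (length \<mu>)" by (induction \<mu>) auto
  then show "w \<in> Poly_Mapping.keys (path_poly \<mu> x) \<Longrightarrow> word_degree w = int (length \<mu>)"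
    by (simp add: path_poly_eq_single word_degree_def)
qed

text \<open>
  A cycle without exits, seen modulo \<open>Q\<close>: every vertex of \<open>C\<close> has a single outgoing edge
  \<open>nxt u\<close> whose range survives, and following these edges from \<open>v\<close> returns to \<open>v\<close> after \<open>m\<close> steps.
\<close>

locale exitless_cycle = lpa_congruence E Q
  for E :: "('v, 'e) pre_digraph" (structure) and Q :: "('v, 'e, 'k::field) lpa_poly set" +
  fixes C :: "'v set" and nxt :: "'v \<Rightarrow> 'e" and v :: 'v and m :: nat
  assumes C_mem: "u \<in> C \<Longrightarrow> vert_poly u \<notin> Q"
    and nxt_arc: "u \<in> C \<Longrightarrow> nxt u \<in> arcs E" and nxt_tail: "u \<in> C \<Longrightarrow> tail E (nxt u) = u"
    and nxt_head: "u \<in> C \<Longrightarrow> head E (nxt u) \<in> C"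
    and exitless: "u \<in> C \<Longrightarrow> f \<in> arcs E \<Longrightarrow> tail E f = u \<Longrightarrow> f \<noteq> nxt u \<Longrightarrow> vert_poly (head E f) \<in> Q"
    and v_C: "v \<in> C" and m_pos: "m > 0" and period: "((\<lambda>u. head E (nxt u)) ^^ m) v = v"
begin

definition pos :: "nat \<Rightarrow> 'v" where "pos i = ((\<lambda>u. head E (nxt u)) ^^ i) v"

definition trail_from :: "nat \<Rightarrow> 'e list" where "trail_from i = map (\<lambda>j. nxt (pos j)) [0..<i]"

abbreviation trail_poly :: "nat \<Rightarrow> ('v, 'e, 'k) lpa_poly"
  where "trail_poly i \<equiv> path_poly (trail_from i) (pos i)"

lemma pos_0 [simp]: "pos 0 = v" and pos_Suc: "pos (Suc i) = head E (nxt (pos i))"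
  and pos_m [simp]: "pos m = v"
  using period by (simp_all add: pos_def)

lemma pos_C: "pos i \<in> C"
  by (induction i) (auto simp: v_C pos_Suc nxt_head)

lemma trail_0 [simp]: "trail_from 0 = []" and trail_Suc: "trail_from (Suc i) = trail_from i @ [nxt (pos i)]"
  and length_trail [simp]: "length (trail_from i) = i"
  by (simp_all add: trail_from_def)

lemma v_verts: "v \<in> verts E" using C_mem[OF v_C] outside_vertex by blast

lemma awalk_snoc_iff: "awalk s (\<mu> @ [e]) x \<longleftrightarrow> awalk s \<mu> (tail E e) \<and> e \<in> arcs E \<and> head E e = x"
  by (induction \<mu> arbitrary: s) (auto simp: awalk_Cons_iff awalk_Nil_iff)

lemma awalk_trail: "awalk v (trail_from i) (pos i)"
proof (induction i)
  case (Suc i)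
  then show ?case unfolding trail_Suc pos_Suc awalk_snoc_iff by (simp add: pos_C nxt_arc nxt_tail)
qed (simp add: awalk_Nil_iff v_verts)

lemma path_unique:
  assumes "awalk v \<nu> y" "vert_poly y \<notin> Q"
  shows "\<nu> = trail_from (length \<nu>) \<and> y = pos (length \<nu>)"
  using assms
proof (induction \<nu> arbitrary: y rule: rev_induct)
  case Nil
  then have "y = v" by (simp add: awalk_Nil_iff)
  then show ?case by simp
next
  case (snoc e \<nu>)
  then have e: "awalk v \<nu> (tail E e)" "e \<in> arcs E" "head E e = y" by (auto simp: awalk_snoc_iff)
  then have "tail E e \<rightarrow>\<^sup>* y" by (auto intro!: reachable_awalkI[of _ "[e]"] simp: awalk_Cons_iff awalk_Nil_iff)
  then have "vert_poly (tail E e) \<notin> Q" using snoc.prems(2) vertex_mem_reachable by blast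
  from snoc.IH[OF e(1) this] have IH: "\<nu> = trail_from (length \<nu>)" "tail E e = pos (length \<nu>)" by auto
  have "e = nxt (pos (length \<nu>))"
    using exitless[OF pos_C e(2) IH(2)] e(3) snoc.prems(2) by blast
  then show ?case using IH(1) e(3) by (simp add: trail_Suc pos_Suc)
qed

text \<open>
  Modulo \<open>Q\<close> the trail of length \<open>k\<close> is the only path from \<open>v\<close> among the maximal ones, because no
  vertex of \<open>C\<close> is a sink. So a single path detects membership of $a v$.
\<close>

lemma mem_if_trail:
  assumes "a * trail_poly k \<in> Q"
  shows "a * vert_poly v \<in> Q"
proof (rule mem_if_paths_right[OF v_verts, of k])
  fix \<nu> y assume "(\<nu>, y) \<in> maximal_paths k v"
  then have y: "awalk v \<nu> y" "length \<nu> = k \<or> out_arcs E y = {}" by (auto simp: maximal_paths_def)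
  show "a * path_poly \<nu> y \<in> Q"
  proof (cases "vert_poly y \<in> Q")
    case True
    then show ?thesis by (intro mult_mem_left path_mem)
  next
    case False
    from path_unique[OF y(1) False] have \<nu>: "\<nu> = trail_from (length \<nu>)" "y = pos (length \<nu>)" by auto
    have "nxt y \<in> out_arcs E y" using \<nu>(2) pos_C nxt_arc nxt_tail by simp
    with y(2) have "length \<nu> = k" by blast
    with \<nu> assms show ?thesis by metis
  qed
qed

lemma trail_poly_Suc: "trail_poly (Suc k) \<approx> trail_poly k * edge_poly (nxt (pos k))"
  unfolding trail_Suc pos_Suc by (rule path_snoc) (simp_all add: pos_C nxt_arc nxt_tail)

text \<open>
  After compression to \<open>v\<close>, a word acts on the trails as zero or as the shift by its degree.
  Which of the two happens does not depend on the length of the trail: a longer trail arises by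
  multiplying with edges from the right, and the invariant \<open>pos (k + d) = pos k\<close> guarantees that
  the same edge is appended on both sides.
\<close>

lemma word_on_trail:
  "\<exists>\<delta>. (\<delta> = 0 \<or> \<delta> = 1) \<and> (\<forall>k\<ge>length (letters w).
    vert_poly v * Poly_Mapping.single w 1 * trail_poly k \<approx> \<delta> * trail_poly (nat (int k + word_degree w)))"
proof -
  let ?W = "Poly_Mapping.single w 1 :: ('v, 'e, 'k) lpa_poly"
  let ?t = "\<lambda>k. nat (int k + word_degree w)"
  let ?L = "length (letters w)"
  \<comment> \<open>The shortest admissible trail decides which alternative holds.\<close>
  have "\<exists>\<delta>. (\<delta> = 0 \<or> \<delta> = 1 \<and> pos (?t ?L) = pos ?L) \<and>
      vert_poly v * ?W * trail_poly ?L \<approx> \<delta> * trail_poly (?t ?L)"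
  proof -
    have zero: ?thesis if "vert_poly v * ?W * trail_poly ?L \<in> Q"
      using that by (intro exI[of _ 0]) (simp add: cong_zero_iff)
    from word_on_path[OF awalk_trail, of w ?L] consider "?W * trail_poly ?L \<in> Q"
      | s \<nu> where "awalk s \<nu> (pos ?L)" "int (length \<nu>) = int ?L + word_degree w"
        "?W * trail_poly ?L \<approx> path_poly \<nu> (pos ?L)"
      by auto
    then show ?thesis
    proof cases
      case 1
      then show ?thesis using mult_mem_left by (intro zero) (simp add: mult.assoc)
    next
      case (2 s \<nu>)
      have red: "vert_poly v * ?W * trail_poly ?L \<approx> vert_poly v * path_poly \<nu> (pos ?L)"
        using cong_mult_left[OF 2(3)] by (simp add: mult.assoc)
      show ?thesis
      proof (cases "s = v")
        case False
        then show ?thesis using source_path_orth[OF 2(1)] cong_mem_iff[OF red] by (intro zero) auto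
      next
        case True
        then have w: "awalk v \<nu> (pos ?L)" using 2(1) by simp
        have len: "length \<nu> = ?t ?L" using 2(2) by simp
        from path_unique[OF w C_mem[OF pos_C]] have \<nu>: "\<nu> = trail_from (?t ?L)" "pos ?L = pos (?t ?L)"
          by (simp_all add: len)
        have "vert_poly v * ?W * trail_poly ?L \<approx> path_poly \<nu> (pos ?L)"
          by (rule cong_trans[OF red source_path[OF w]])
        then show ?thesis by (intro exI[of _ 1]) (simp add: \<nu>)
      qed
    qed
  qed
  then obtain \<delta> where \<delta>: "\<delta> = 0 \<or> \<delta> = 1 \<and> pos (?t ?L) = pos ?L"
    and base: "vert_poly v * ?W * trail_poly ?L \<approx> \<delta> * trail_poly (?t ?L)" by blast
  have "vert_poly v * ?W * trail_poly k \<approx> \<delta> * trail_poly (?t k) \<and> (\<delta> = 1 \<longrightarrow> pos (?t k) = pos k)"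
    if "k \<ge> ?L" for k
    using that
  proof (induction k rule: dec_induct)
    case base
    then show ?case using \<delta> \<open>vert_poly v * ?W * trail_poly ?L \<approx> _\<close> by auto
  next
    case (step k)
    have t: "?t (Suc k) = Suc (?t k)" using step.hyps(1) abs_word_degree_le[of w] by simp
    let ?e = "edge_poly (nxt (pos k)) :: ('v, 'e, 'k) lpa_poly"
    have "vert_poly v * ?W * trail_poly (Suc k) \<approx> vert_poly v * ?W * (trail_poly k * ?e)"
      by (intro cong_mult_left trail_poly_Suc)
    also have "\<dots> = vert_poly v * ?W * trail_poly k * ?e" by (simp add: mult.assoc)
    also have "\<dots> \<approx> \<delta> * trail_poly (?t k) * ?e" using step.IH by (intro cong_mult_right) simp
    also have "\<dots> \<approx> \<delta> * trail_poly (Suc (?t k))"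
    proof (cases "\<delta> = 0")
      case False
      with \<delta> step.IH have "\<delta> = 1" "pos (?t k) = pos k" by auto
      then show ?thesis using cong_sym[OF trail_poly_Suc[of "?t k"]] by simp
    qed simp
    finally show ?case using step.IH unfolding t by (auto simp: pos_Suc)
  qed
  then show ?thesis using \<delta> by blast
qed

definition corner :: "('v, 'e, 'k) lpa_poly \<Rightarrow> ('v, 'e, 'k) lpa_poly"
  where "corner a = vert_poly v * a * vert_poly v"

lemma corner_add: "corner (a + b) = corner a + corner b"
  by (simp add: corner_def ring_distribs)

lemma corner_zero [simp]: "corner 0 = 0" by (simp add: corner_def)

lemma corner_single: "corner (Poly_Mapping.single w c) = const_poly c * corner (Poly_Mapping.single w 1)"
  unfolding corner_def by (rule single_between)

lemma vert_corner: "vert_poly v * corner a \<approx> corner a"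
  using cong_mult_right[OF vert_idem[of v], of "a * vert_poly v"] by (simp add: corner_def mult.assoc)

lemma corner_vert: "corner a * vert_poly v \<approx> corner a"
  using cong_mult_left[OF vert_idem[of v], of "vert_poly v * a"] by (simp add: corner_def mult.assoc)

text \<open>
  Shifts commute, provided that the trail is long enough for both words to act one after the
  other.
\<close>

lemma corner_words_commute:
  "corner (Poly_Mapping.single w 1) * corner (Poly_Mapping.single w' 1) \<approx>
   corner (Poly_Mapping.single w' 1) * corner (Poly_Mapping.single w 1)"
proof -
  let ?c = "\<lambda>w. corner (Poly_Mapping.single w 1)"
  obtain \<delta> where \<delta>: "\<And>w. \<delta> w = 0 \<or> \<delta> w = 1"
    and \<delta>_act: "\<And>w k. length (letters w) \<le> k \<Longrightarrow> vert_poly v * Poly_Mapping.single w 1 * trail_poly k \<approx>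
      \<delta> w * trail_poly (nat (int k + word_degree w))"
    using word_on_trail by metis
  have act: "?c w * trail_poly k \<approx> \<delta> w * trail_poly (nat (int k + word_degree w))"
    if "length (letters w) \<le> k" for w k
  proof -
    have "?c w * trail_poly k = vert_poly v * Poly_Mapping.single w 1 * (vert_poly v * trail_poly k)"
      by (simp add: corner_def mult.assoc)
    also have "\<dots> \<approx> vert_poly v * Poly_Mapping.single w 1 * trail_poly k"
      by (intro cong_mult_left source_path awalk_trail)
    also have "\<dots> \<approx> \<delta> w * trail_poly (nat (int k + word_degree w))" by (rule \<delta>_act[OF that])
    finally show ?thesis .
  qed
  have act2: "?c w * ?c w' * trail_poly (length (letters w) + length (letters w')) \<approx>
      \<delta> w * \<delta> w' * trail_poly (nat (int (length (letters w) + length (letters w')) + word_degree w + word_degree w'))"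
    for w w'
  proof -
    let ?k = "length (letters w) + length (letters w')"
    let ?j = "nat (int ?k + word_degree w')"
    have j: "length (letters w) \<le> ?j" using abs_word_degree_le[of w'] by simp
    have "?c w * ?c w' * trail_poly ?k = ?c w * (?c w' * trail_poly ?k)" by (simp add: mult.assoc)
    also have "\<dots> \<approx> ?c w * (\<delta> w' * trail_poly ?j)" by (intro cong_mult_left act) simp
    also have "\<dots> = \<delta> w' * (?c w * trail_poly ?j)" using \<delta>[of w'] by auto
    also have "\<dots> \<approx> \<delta> w' * (\<delta> w * trail_poly (nat (int ?j + word_degree w)))"
      by (intro cong_mult_left act j)
    also have "\<dots> = \<delta> w * \<delta> w' * trail_poly (nat (int ?j + word_degree w))" using \<delta>[of w] \<delta>[of w'] by auto
    also have "int ?j + word_degree w = int ?k + word_degree w + word_degree w'"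
      using abs_word_degree_le[of w'] by simp
    finally show ?thesis .
  qed
  have comm: "\<delta> w * \<delta> w' = \<delta> w' * \<delta> w" using \<delta>[of w] \<delta>[of w'] by auto
  have "?c w * ?c w' * trail_poly (length (letters w) + length (letters w')) \<approx>
      ?c w' * ?c w * trail_poly (length (letters w) + length (letters w'))"
    using act2[of w w'] cong_sym[OF act2[of w' w]]
    by (simp add: comm add.commute add.left_commute) (rule cong_trans)
  then have "(?c w * ?c w' - ?c w' * ?c w) * vert_poly v \<in> Q"
    by (intro mem_if_trail) (simp add: cong_def left_diff_distrib)
  then have "?c w * ?c w' * vert_poly v \<approx> ?c w' * ?c w * vert_poly v"
    by (simp add: cong_def left_diff_distrib)
  moreover have "?c w * ?c w' * vert_poly v \<approx> ?c w * ?c w'" for w w'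
    using cong_mult_left[OF corner_vert] by (simp add: mult.assoc)
  ultimately show ?thesis by (meson cong_trans cong_sym)
qed

lemma corner_commute: "corner a * corner b \<approx> corner b * corner a"
proof -
  have const: "p * (const_poly c * q) = const_poly c * (p * q)" for p q :: "('v, 'e, 'k) lpa_poly" and c
    by (simp only: mult.assoc[symmetric] const_poly_commute[of c p])
  show ?thesis
  proof (induction a rule: ncpoly_induct)
    case (single w c)
    have "corner (Poly_Mapping.single w 1) * corner b \<approx> corner b * corner (Poly_Mapping.single w 1)"
    proof (induction b rule: ncpoly_induct)
      case (single w' c')
      show ?case
        using cong_mult_left[OF corner_words_commute[of w w'], of "const_poly c'"]
        by (simp only: corner_single[of w' c'] const mult.assoc)
    qed (simp_all add: corner_add ring_distribs cong_add)
    from cong_mult_left[OF this, of "const_poly c"] show ?case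
      by (simp only: corner_single[of w c] const mult.assoc)
  qed (simp_all add: corner_add ring_distribs cong_add)
qed

lemma commute_if_corner: "a \<approx> corner a \<Longrightarrow> b \<approx> corner b \<Longrightarrow> a * b \<approx> b * a"
  by (meson cong_mult cong_sym cong_trans corner_commute)

abbreviation cyc :: "('v, 'e, 'k) lpa_poly" where "cyc \<equiv> path_poly (trail_from m) v"

lemma awalk_cyc: "awalk v (trail_from m) v"
  using awalk_trail[of m] by simp

lemma cyc_corner: "cyc \<approx> corner cyc"
proof -
  have "corner cyc \<approx> cyc * vert_poly v"
    unfolding corner_def by (intro cong_mult_right source_path awalk_cyc)
  also have "\<dots> \<approx> cyc" by (rule path_poly_range)
  finally show ?thesis by (rule cong_sym)
qed

lemma vert_plus_cyc_corner: "vert_poly v + cyc \<approx> corner (vert_poly v + cyc)"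
proof -
  have "corner (vert_poly v) \<approx> vert_poly v * vert_poly v"
    unfolding corner_def by (intro cong_mult_right vert_idem)
  also have "\<dots> \<approx> vert_poly v" by (rule vert_idem)
  finally show ?thesis unfolding corner_add by (intro cong_add cyc_corner) (rule cong_sym)
qed

text \<open>
  The two summands have the different degrees \<open>0\<close> and \<open>m\<close>.
\<close>

lemma vert_plus_cyc_not_mem:
  assumes graded: "\<And>p n. p \<in> Q \<Longrightarrow> homogeneous_part n p \<in> Q"
  shows "vert_poly v + cyc \<notin> Q"
proof
  assume "vert_poly v + cyc \<in> Q"
  then have "homogeneous_part 0 (vert_poly v + cyc) \<in> Q" by (rule graded)
  moreover have "homogeneous_part 0 (vert_poly v :: ('v, 'e, 'k) lpa_poly) = vert_poly v"
    using keys_path_poly_degree[of _ "[]" v] by (intro filter_words_all) auto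
  moreover have "homogeneous_part 0 cyc = 0"
    using keys_path_poly_degree[of _ "trail_from m" v] m_pos by (intro filter_words_none) auto
  ultimately show False using C_mem[OF v_C] by (simp add: filter_words_add)
qed

text \<open>
  As in the Laurent polynomial ring, the homogeneous components of an inverse \<open>b\<close> of $v + c$
  satisfy $b_n = \delta_{n,0} v - c b_{n-m}$. Finiteness of the support from below gives
  $b_n = 0$ for \<open>n < 0\<close>, hence $b_0 = v$ and $b_{jm} = (-c)^j$, which never vanishes because
  $c^* c = v$. This contradicts finiteness of the support from above.
\<close>

lemma vert_plus_cyc_not_invertible:
  assumes graded: "\<And>p n. p \<in> Q \<Longrightarrow> homogeneous_part n p \<in> Q"
    and b: "b \<approx> corner b"
  shows "\<not> (vert_poly v + cyc) * b \<approx> vert_poly v"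
proof
  let ?V = "vert_poly v :: ('v, 'e, 'k) lpa_poly"
  assume inv: "(?V + cyc) * b \<approx> ?V"
  define h where "h n = homogeneous_part n b" for n
  have keyV: "w \<in> Poly_Mapping.keys ?V \<Longrightarrow> word_degree w = 0" for w
    using keys_path_poly_degree[of w "[]" v] by simp
  have keyc: "w \<in> Poly_Mapping.keys cyc \<Longrightarrow> word_degree w = int m" for w
    using keys_path_poly_degree[of w "trail_from m" v] by simp
  have partV: "homogeneous_part n ?V = (if n = 0 then ?V else 0)" for n
    using keyV by (auto intro: filter_words_all filter_words_none)
  have Vh: "?V * h n \<approx> h n" for n
  proof -
    have "?V * b \<approx> ?V * corner b" by (rule cong_mult_left[OF b])
    also have "\<dots> \<approx> corner b" by (rule vert_corner)
    also have "\<dots> \<approx> b" by (rule cong_sym[OF b])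
    finally have "homogeneous_part n (?V * b - b) \<in> Q" unfolding cong_def by (rule graded)
    then show ?thesis
      by (simp add: h_def cong_def filter_words_diff homogeneous_part_mult_left[OF keyV])
  qed
  have rec: "h n \<approx> (if n = 0 then ?V else 0) - cyc * h (n - int m)" for n
  proof -
    have "homogeneous_part n ((?V + cyc) * b - ?V) \<in> Q"
      using inv unfolding cong_def by (rule graded)
    moreover have "homogeneous_part n ((?V + cyc) * b - ?V) =
        ?V * h n + cyc * h (n - int m) - (if n = 0 then ?V else 0)"
      by (simp add: h_def filter_words_diff filter_words_add distrib_right partV
          homogeneous_part_mult_left[OF keyV] homogeneous_part_mult_left[OF keyc])
    ultimately have "?V * h n + cyc * h (n - int m) \<approx> (if n = 0 then ?V else 0)"
      by (simp only: cong_def)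
    from cong_diff[OF this cong_refl[of "cyc * h (n - int m)"]]
    have "?V * h n \<approx> (if n = 0 then ?V else 0) - cyc * h (n - int m)" by simp
    then show ?thesis using Vh cong_sym cong_trans by blast
  qed
  obtain K :: nat where K: "\<And>w. w \<in> Poly_Mapping.keys b \<Longrightarrow> length (letters w) \<le> K"
    using finite_nat_set_iff_bounded_le[of "(\<lambda>w. length (letters w)) ` Poly_Mapping.keys b"] by auto
  have bound: "h n = 0" if "\<bar>n\<bar> > int K" for n
    unfolding h_def
  proof (rule filter_words_none)
    fix w assume "w \<in> Poly_Mapping.keys b"
    then show "word_degree w \<noteq> n" using K[of w] abs_word_degree_le[of w] that by auto
  qed
  \<comment> \<open>Below degree \<open>-K\<close> the components vanish; the recursion propagates this up to degree \<open>-1\<close>.\<close>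
  have neg: "h n \<in> Q" if "n < 0" for n
    using that
  proof (induction "nat (n + int K + 1)" arbitrary: n rule: less_induct)
    case less
    show ?case
    proof (cases "n + int K + 1 > 0")
      case True
      have "h (n - int m) \<in> Q" using less.prems m_pos True by (intro less.hyps) auto
      then have "cyc * h (n - int m) \<in> Q" by (rule mult_mem_left)
      then have "0 - cyc * h (n - int m) \<in> Q" by (intro diff_mem zero_mem)
      then show ?thesis using cong_mem_iff[OF rec[of n]] less.prems by simp
    next
      case False
      then have "h n = 0" by (intro bound) auto
      then show ?thesis by (simp add: zero_mem)
    qed
  qed
  have h0: "h 0 \<notin> Q"
  proof
    assume "h 0 \<in> Q"
    then have "?V - cyc * h (0 - int m) \<in> Q" using cong_mem_iff[OF rec[of 0]] by simp
    moreover have "cyc * h (0 - int m) \<in> Q" using m_pos by (intro mult_mem_left neg) simp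
    ultimately have "?V - cyc * h (0 - int m) + cyc * h (0 - int m) \<in> Q" by (rule add_mem)
    then show False using C_mem[OF v_C] by simp
  qed
  \<comment> \<open>Multiplication by \<open>c\<close> is injective on the corner, having the left inverse $c^*$.\<close>
  have "h (int (j * m)) \<notin> Q" for j
  proof (induction j)
    case 0
    then show ?case using h0 by simp
  next
    case (Suc j)
    show ?case
    proof
      assume *: "h (int (Suc j * m)) \<in> Q"
      have "int (Suc j * m) \<noteq> 0" "int (Suc j * m) - int m = int (j * m)"
        using m_pos by (simp_all add: algebra_simps flip: of_nat_mult of_nat_add)
      then have "- (cyc * h (int (j * m))) \<in> Q"
        using cong_mem_iff[OF rec[of "int (Suc j * m)"]] * by (simp del: of_nat_mult mult_Suc)
      from uminus_mem[OF this] have "cyc * h (int (j * m)) \<in> Q" by simp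
      then have "ghost_path_poly (trail_from m) v * cyc * h (int (j * m)) \<in> Q"
        using mult_mem_left by (simp add: mult.assoc)
      moreover have "ghost_path_poly (trail_from m) v * cyc * h (int (j * m)) \<approx> ?V * h (int (j * m))"
        by (rule cong_mult_right[OF ghost_path_path[OF awalk_cyc]])
      ultimately have "h (int (j * m)) \<in> Q" using Vh[of "int (j * m)"] by (simp add: cong_mem_iff)
      with Suc show False by simp
    qed
  qed
  moreover have "K < Suc K * m" using m_pos by (cases m) auto
  then have "int K < int (Suc K * m)" by (simp only: of_nat_less_iff)
  then have "h (int (Suc K * m)) = 0" by (intro bound) (simp only: abs_of_nat)
  ultimately show False using zero_mem by metis
qed

end

context primitive_lpa_congruence begin

text \<open>
  For a simple module \<open>M\<close>, the space $v M$ is a simple module over the corner at \<open>v\<close>. Since that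
  corner is commutative modulo \<open>Q\<close>, Schur's lemma makes it a field. In the proof \<open>a\<close> represents an
  element with $T a \neq 0$, and \<open>b\<close> is chosen in the corner so that $b T a = v a$; then
  $z = T b - v$ kills $v a$, and by commutativity all of $v M$.
\<close>

lemma corner_invertible:
  assumes "exitless_cycle E Q C nxt v m"
    and T: "T \<approx> exitless_cycle.corner v T" "T \<notin> Q"
  shows "\<exists>b. b \<approx> exitless_cycle.corner v b \<and> T * b \<approx> vert_poly v"
proof -
  interpret exitless_cycle E Q C nxt v m by fact
  let ?V = "vert_poly v"
  have TV: "T * ?V \<approx> T" and VT: "?V * T \<approx> T"
    using cong_trans[OF cong_trans[OF cong_mult_right[OF T(1)] corner_vert] cong_sym[OF T(1)]]
      cong_trans[OF cong_trans[OF cong_mult_left[OF T(1)] vert_corner] cong_sym[OF T(1)]] .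
  obtain a where a: "T * a \<notin> \<Lambda>" using T(2) mem_iff_left by blast
  obtain d where d: "?V * a * d * (T * a) - ?V * a \<in> \<Lambda>" using left_transitive[OF a] by blast
  define b where "b = corner (a * d)"
  have b: "b \<approx> corner b"
  proof -
    have "corner b \<approx> b * ?V" unfolding corner_def b_def by (intro cong_mult_right vert_corner[unfolded corner_def])
    also have "\<dots> \<approx> b" unfolding b_def by (rule corner_vert)
    finally show ?thesis by (rule cong_sym)
  qed
  define z where "z = T * b - ?V"
  have z: "z \<approx> corner z"
  proof -
    have "corner (T * b) = (?V * T) * (b * ?V)" by (simp add: corner_def mult.assoc)
    also have "\<dots> \<approx> T * b" unfolding b_def by (intro cong_mult VT corner_vert)
    finally have 1: "T * b \<approx> corner (T * b)" by (rule cong_sym)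
    have "corner ?V \<approx> ?V * ?V" unfolding corner_def by (intro cong_mult_right vert_idem)
    also have "\<dots> \<approx> ?V" by (rule vert_idem)
    finally have 2: "?V \<approx> corner ?V" by (rule cong_sym)
    have "z \<approx> corner (T * b) - corner ?V" unfolding z_def by (rule cong_diff[OF 1 2])
    also have "\<dots> = corner z" by (simp add: z_def corner_def algebra_simps)
    finally show ?thesis .
  qed
  have za: "z * a \<in> \<Lambda>"
  proof -
    have "z * a = T * b * a - ?V * a" by (simp add: z_def left_diff_distrib)
    also have "\<dots> \<approx> b * T * a - ?V * a"
      by (intro cong_diff cong_refl cong_mult_right commute_if_corner T b)
    also have "\<dots> = ?V * a * d * (?V * T) * a - ?V * a" by (simp add: b_def corner_def mult.assoc)
    also have "\<dots> \<approx> ?V * a * d * T * a - ?V * a"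
      by (intro cong_diff cong_refl cong_mult_right cong_mult_left VT)
    finally show ?thesis using d by (simp add: left_iff_cong mult.assoc)
  qed
  have "?V * a \<notin> \<Lambda>"
  proof
    assume "?V * a \<in> \<Lambda>"
    then have "T * ?V * a \<in> \<Lambda>" using left_mult by (simp add: mult.assoc)
    then show False using a left_iff_cong[OF cong_mult_right[OF TV, of a]] by simp
  qed
  have "z \<in> Q"
    unfolding mem_iff_left
  proof
    fix f
    obtain g where g: "f * g * (?V * a) - f \<in> \<Lambda>" using left_transitive[OF \<open>?V * a \<notin> \<Lambda>\<close>] by blast
    have zV: "z \<approx> z * ?V"
      by (rule cong_trans[OF z cong_trans[OF cong_sym[OF corner_vert]
              cong_mult_right[OF cong_sym[OF z]]]])
    have "z * (f * g * (?V * a) - f) \<in> \<Lambda>" by (rule left_mult[OF g])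
    then have "z * f \<in> \<Lambda> \<longleftrightarrow> z * (f * g * (?V * a)) \<in> \<Lambda>"
      using left_iff[of "z * (f * g * (?V * a))" "z * f"] by (simp add: right_diff_distrib)
    also have "z * (f * g * (?V * a)) = z * (f * g * ?V * a)" by (simp add: mult.assoc)
    also have "z * (f * g * ?V * a) \<in> \<Lambda> \<longleftrightarrow> z * ?V * (f * g * ?V * a) \<in> \<Lambda>"
      by (intro left_iff_cong cong_mult_right zV)
    also have "z * ?V * (f * g * ?V * a) = z * corner (f * g) * a" by (simp add: corner_def mult.assoc)
    also have "z * corner (f * g) * a \<in> \<Lambda> \<longleftrightarrow> corner (f * g) * z * a \<in> \<Lambda>"
    proof (intro left_iff_cong cong_mult_right)
      have "z * corner (f * g) \<approx> corner z * corner (f * g)" by (rule cong_mult_right[OF z])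
      also have "\<dots> \<approx> corner (f * g) * corner z" by (rule corner_commute)
      also have "\<dots> \<approx> corner (f * g) * z" by (rule cong_mult_left[OF cong_sym[OF z]])
      finally show "z * corner (f * g) \<approx> corner (f * g) * z" .
    qed
    also have "corner (f * g) * z * a \<in> \<Lambda>" using left_mult[OF za] by (simp add: mult.assoc)
    finally show "z * f \<in> \<Lambda>" by simp
  qed
  then have "T * b \<approx> ?V" by (simp add: z_def cong_def)
  with b show ?thesis by blast
qed

text \<open>
  It suffices to be given the successor function on the vertices of the cycle: iterating it on a
  finite set runs into a periodic point, which serves as the base vertex.
\<close>

theorem no_exitless_cycle:
  assumes graded: "\<And>p n. p \<in> Q \<Longrightarrow> homogeneous_part n p \<in> Q"
    and C: "C \<noteq> {}" "\<And>u. u \<in> C \<Longrightarrow> vert_poly u \<notin> Q"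
    and nxt: "\<And>u. u \<in> C \<Longrightarrow> nxt u \<in> arcs E \<and> tail E (nxt u) = u \<and> head E (nxt u) \<in> C"
    and exitless: "\<And>u f. u \<in> C \<Longrightarrow> f \<in> arcs E \<Longrightarrow> tail E f = u \<Longrightarrow> f \<noteq> nxt u \<Longrightarrow>
      vert_poly (head E f) \<in> Q"
  shows False
proof -
  let ?s = "\<lambda>u. head E (nxt u)"
  obtain u where u: "u \<in> C" using C(1) by blast
  have orbit: "(?s ^^ i) u \<in> C" for i by (induction i) (auto simp: u nxt)
  have "C \<subseteq> verts E" using C(2) outside_vertex by blast
  then have "finite (range (\<lambda>i. (?s ^^ i) u))"
    using orbit by (intro finite_subset[OF _ finite_verts]) auto
  then have "\<not> inj (\<lambda>i. (?s ^^ i) u)" using finite_imageD by blast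
  then obtain i j where ij: "i < j" "(?s ^^ i) u = (?s ^^ j) u"
    unfolding inj_on_def by (metis nat_neq_iff)
  define v where "v = (?s ^^ i) u"
  have "(?s ^^ (j - i)) v = (?s ^^ (j - i + i)) u" unfolding v_def by (simp only: funpow_add o_apply)
  then have per: "(?s ^^ (j - i)) v = v" using ij by (simp add: v_def)
  have ex: "exitless_cycle E Q C nxt v (j - i)"
    by unfold_locales (use C nxt exitless per ij orbit in \<open>auto simp: v_def\<close>)
  then interpret exitless_cycle E Q C nxt v "j - i" .
  from corner_invertible[OF ex vert_plus_cyc_corner vert_plus_cyc_not_mem[OF graded]]
  show False using vert_plus_cyc_not_invertible[OF graded] by blast
qed

end

section \<open>From the free algebra to the Leavitt path algebra\<close>

text \<open>
  Every defining relation is homogeneous, and therefore so is the ideal that they generate.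
\<close>

lemma homogeneous_relation:
  assumes "r \<in> (lpa_relations E :: ('v, 'e, 'k::field) lpa_poly set)"
  shows "\<exists>d. \<forall>n. homogeneous_part n r = (if n = d then r else 0)"
proof -
  have g: "homogeneous_part n (gen g) = (if n = gen_degree g then gen g else 0)"
    for n and g :: "('v, 'e) lpa_gen"
    by (auto simp: gen_def filter_words_single)
  have gg: "homogeneous_part n (gen g * gen h) =
      (if n = gen_degree g + gen_degree h then gen g * gen h else 0)"
    for n and g h :: "('v, 'e) lpa_gen"
    by (auto simp: gen_def mult_single filter_words_single plus_free_word_def)
  show ?thesis
    using assms unfolding lpa_relations_def
  proof (elim UnE CollectE exE conjE, goal_cases)
    case 1
    then show ?case by (intro exI[of _ "0::int"]) (auto simp: filter_words_diff filter_words_sum g gg)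
  next
    case 2
    then show ?case by (intro exI[of _ "0::int"]) (auto simp: filter_words_diff filter_words_sum g gg)
  next
    case 3
    then show ?case by (intro exI[of _ "1::int"]) (auto simp: filter_words_diff filter_words_sum g gg)
  next
    case 4
    then show ?case by (intro exI[of _ "1::int"]) (auto simp: filter_words_diff filter_words_sum g gg)
  next
    case 5
    then show ?case by (intro exI[of _ "-1::int"]) (auto simp: filter_words_diff filter_words_sum g gg)
  next
    case 6
    then show ?case by (intro exI[of _ "-1::int"]) (auto simp: filter_words_diff filter_words_sum g gg)
  next
    case 7
    then show ?case by (intro exI[of _ "0::int"]) (auto simp: filter_words_diff filter_words_sum g gg)
  next
    case 8
    then show ?case by (intro exI[of _ "0::int"]) (auto simp: filter_words_diff filter_words_sum g gg)
  next
    case 9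
    then show ?case by (intro exI[of _ "0::int"]) (auto simp: filter_words_diff filter_words_sum g gg)
  qed
qed

context fin_digraph begin

abbreviation LPA :: "('a, 'b, 'k::field) lpa_poly set ring"
  where "LPA \<equiv> leavitt_path_algebra G"

definition lpa_unit :: "('a, 'b, 'k::field) lpa_poly"
  where "lpa_unit = (\<Sum>v\<in>verts G. gen (Vertex v))"

definition restrict_poly :: "('a, 'b, 'k::field) lpa_poly \<Rightarrow> ('a, 'b, 'k) lpa_poly"
  where "restrict_poly = filter_words (\<lambda>w. set (letters w) \<subseteq> lpa_gens G)"

text \<open>
  The factor \<open>lpa_unit\<close> moves constants into the nonunital part, so that \<open>lpa_map\<close> becomes a unital
  ring homomorphism from the whole free algebra.
\<close>

definition lpa_map :: "('a, 'b, 'k::field) lpa_poly \<Rightarrow> ('a, 'b, 'k) lpa_poly set"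
  where "lpa_map p = lpa_class G (lpa_unit * restrict_poly p)"

lemma unit_nonunital: "lpa_unit \<in> nonunital_part (lpa_gens G)"
  unfolding lpa_unit_def by (intro nonunital_sum gen_nonunital) (simp add: lpa_gens_def)

lemma restrict_poly_carrier: "restrict_poly p \<in> carrier (free_algebra (lpa_gens G))"
  by (simp add: restrict_poly_def free_algebra_carrier_iff keys_filter_words)

lemma restrict_poly_id: "p \<in> carrier (free_algebra (lpa_gens G)) \<Longrightarrow> restrict_poly p = p"
  unfolding restrict_poly_def by (rule filter_words_all) (simp add: free_algebra_carrier_iff)

lemma restrict_poly_add: "restrict_poly (p + q) = restrict_poly p + restrict_poly q"
  by (simp add: restrict_poly_def filter_words_add)

lemma restrict_poly_mult: "restrict_poly (p * q) = restrict_poly p * restrict_poly q"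
  unfolding restrict_poly_def by (rule filter_words_mult) (simp add: plus_free_word_def)

lemma nonunital_carrier: "p \<in> nonunital_part X \<Longrightarrow> p \<in> carrier (free_algebra X)"
  by (simp add: nonunital_part_def)

lemma unit_mult_nonunital:
  "p \<in> carrier (free_algebra (lpa_gens G)) \<Longrightarrow> lpa_unit * p \<in> nonunital_part (lpa_gens G)"
  using unit_nonunital free_algebra_closed(2)[of lpa_unit "lpa_gens G" p]
  by (auto simp: nonunital_part_def lookup_zero_mult)

lemma unit_left: "p \<in> nonunital_part (lpa_gens G) \<Longrightarrow> lpa_unit * p - p \<in> lpa_ideal G"
  and unit_right: "p \<in> nonunital_part (lpa_gens G) \<Longrightarrow> p * lpa_unit - p \<in> lpa_ideal G"
  unfolding lpa_unit_def using lpa_one[OF wf_digraph finite_verts] by auto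

lemma lpa_map_nonunital:
  assumes "p \<in> nonunital_part (lpa_gens G)"
  shows "lpa_map p = lpa_class G p"
  unfolding lpa_map_def restrict_poly_id[OF nonunital_carrier[OF assms]]
  by (intro lpa_class_eqI wf_digraph unit_left assms nonunital_carrier unit_mult_nonunital)

lemma lpa_ring: "ring LPA"
  by (rule ring_leavitt_path_algebra[OF wf_digraph finite_verts])

lemma carrier_LPA: "carrier LPA = lpa_class G ` nonunital_part (lpa_gens G)"
  by (simp add: leavitt_path_algebra_def)

lemma lpa_map_closed: "lpa_map p \<in> carrier LPA"
  unfolding lpa_map_def carrier_LPA by (intro imageI unit_mult_nonunital restrict_poly_carrier)

lemma lpa_map_surj:
  assumes "a \<in> carrier LPA"
  obtains p where "a = lpa_map p"
  using assms lpa_map_nonunital unfolding carrier_LPA by blast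

lemma lpa_map_add: "lpa_map (p + q) = lpa_map p \<oplus>\<^bsub>LPA\<^esub> lpa_map q"
  unfolding lpa_map_def
  by (subst lpa_class_ops(1)[OF wf_digraph])
    (simp_all add: unit_mult_nonunital restrict_poly_carrier restrict_poly_add distrib_left)

lemma lpa_map_mult:
  fixes p q :: "('a, 'b, 'k::field) lpa_poly"
  shows "lpa_map (p * q) = lpa_map p \<otimes>\<^bsub>LPA\<^esub> lpa_map q"
proof -
  let ?u = "lpa_unit :: ('a, 'b, 'k) lpa_poly"
  let ?p = "restrict_poly p" and ?q = "restrict_poly q"
  have N: "?u * ?p \<in> nonunital_part (lpa_gens G)" "?u * ?q \<in> nonunital_part (lpa_gens G)"
    by (simp_all add: unit_mult_nonunital restrict_poly_carrier)
  have "((?u * ?p) * ?u - ?u * ?p) * ?q \<in> lpa_ideal G"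
    by (intro lpa_ideal_closed(2)[OF wf_digraph] unit_right N restrict_poly_carrier)
  then have "(?u * ?p) * (?u * ?q) - ?u * (?p * ?q) \<in> lpa_ideal G"
    by (simp add: algebra_simps)
  then have "lpa_class G ((?u * ?p) * (?u * ?q)) = lpa_class G (?u * (?p * ?q))"
    by (intro lpa_class_eqI wf_digraph nonunital_carrier nonunital_part_closed(2) N
        unit_mult_nonunital free_algebra_closed restrict_poly_carrier)
  then show ?thesis
    unfolding lpa_map_def using N by (simp add: lpa_class_ops(2)[OF wf_digraph] restrict_poly_mult)
qed

lemma lpa_map_one: "lpa_map 1 = \<one>\<^bsub>LPA\<^esub>"
  by (simp add: lpa_map_def restrict_poly_id leavitt_path_algebra_def lpa_unit_def)

lemma lpa_map_zero: "lpa_map 0 = (\<zero>\<^bsub>LPA\<^esub> :: ('a, 'b, 'k::field) lpa_poly set)"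
proof -
  interpret L: ring "LPA :: ('a, 'b, 'k) lpa_poly set ring" by (rule lpa_ring)
  have "lpa_map 0 \<oplus>\<^bsub>LPA\<^esub> lpa_map 0 = (lpa_map 0 :: ('a, 'b, 'k) lpa_poly set)"
    by (simp flip: lpa_map_add)
  then show ?thesis using L.add.r_cancel_one[OF lpa_map_closed lpa_map_closed] by simp
qed

lemma lpa_map_eq_zero_iff:
  fixes p :: "('a, 'b, 'k::field) lpa_poly"
  shows "lpa_map p = \<zero>\<^bsub>LPA\<^esub> \<longleftrightarrow> lpa_unit * restrict_poly p \<in> lpa_ideal G"
proof -
  let ?F = "free_algebra (lpa_gens G) :: ('a, 'b, 'k) lpa_poly ring"
  interpret I: ideal "lpa_ideal G" ?F by (rule ideal_lpa_ideal[OF wf_digraph])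
  let ?q = "lpa_unit * restrict_poly p"
  have q: "?q \<in> carrier ?F"
    by (intro nonunital_carrier unit_mult_nonunital restrict_poly_carrier)
  have zero: "\<zero>\<^bsub>LPA\<^esub> = lpa_class G (0 :: ('a, 'b, 'k) lpa_poly)"
    unfolding lpa_map_zero[symmetric]
    by (intro lpa_map_nonunital) (rule nonunital_part_closed(4)[OF unit_nonunital unit_nonunital])
  have class0: "lpa_class G 0 = (lpa_ideal G :: ('a, 'b, 'k) lpa_poly set)"
    using I.a_coset_add_zero[OF I.a_subset] by (simp add: lpa_class_def)
  have "?q \<in> lpa_class G ?q"
    using lpa_ideal_closed(4)[OF wf_digraph] by (force simp: lpa_class_def a_r_coset_def')
  moreover have "?q \<in> lpa_ideal G \<Longrightarrow> lpa_class G ?q = lpa_class G 0"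
    using q by (intro lpa_class_eqI wf_digraph) auto
  ultimately show ?thesis unfolding zero lpa_map_def class0 by auto
qed

lemma lpa_map_sum:
  fixes f :: "'i \<Rightarrow> ('a, 'b, 'k::field) lpa_poly"
  assumes "finite N"
  shows "lpa_map (\<Sum>i\<in>N. f i) = (\<Oplus>\<^bsub>LPA\<^esub>i\<in>N. lpa_map (f i))"
proof -
  interpret L: ring "LPA :: ('a, 'b, 'k) lpa_poly set ring" by (rule lpa_ring)
  show ?thesis
    using assms by (induction N) (simp_all add: lpa_map_zero lpa_map_add lpa_map_closed)
qed

lemma lpa_congruence_pullback:
  fixes I :: "('a, 'b, 'k::field) lpa_poly set set"
  assumes "ideal I LPA"
  shows "lpa_congruence G {p. lpa_map p \<in> I}"
proof -
  interpret I: ideal I "LPA :: ('a, 'b, 'k) lpa_poly set ring" by fact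
  have ker: "lpa_map p \<in> I" if "lpa_unit * restrict_poly p \<in> lpa_ideal G" for p :: "('a, 'b, 'k) lpa_poly"
    using that I.zero_closed unfolding lpa_map_eq_zero_iff[symmetric] by simp
  have u: "lpa_unit \<in> carrier (free_algebra (lpa_gens G))"
    by (rule nonunital_carrier[OF unit_nonunital])
  show ?thesis
  proof
    show "lpa_relations G \<subseteq> {p. lpa_map p \<in> I}"
    proof
      fix r :: "('a, 'b, 'k) lpa_poly" assume r: "r \<in> lpa_relations G"
      then have "r \<in> carrier (free_algebra (lpa_gens G))"
        using lpa_relations_carrier[OF wf_digraph] by blast
      moreover have "lpa_unit * r \<in> lpa_ideal G"
        using lpa_relations_in_ideal r by (intro lpa_ideal_closed(3)[OF wf_digraph] u) blast
      ultimately show "r \<in> {p. lpa_map p \<in> I}" by (simp add: ker restrict_poly_id)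
    qed
    show "gen g \<in> {p. lpa_map p \<in> I}" if "g \<notin> lpa_gens G" for g
    proof -
      have "restrict_poly (gen g) = (0 :: ('a, 'b, 'k) lpa_poly)"
        unfolding restrict_poly_def using that by (auto simp: gen_def filter_words_single)
      then show ?thesis by (simp add: ker lpa_ideal_closed(4)[OF wf_digraph])
    qed
    have "lpa_unit * (1 - lpa_unit) = - (lpa_unit * lpa_unit - lpa_unit :: ('a, 'b, 'k) lpa_poly)"
      by (simp add: algebra_simps)
    also have "\<dots> = (lpa_unit * lpa_unit - lpa_unit) * (- 1)" by simp
    also have "\<dots> \<in> lpa_ideal G"
      using free_algebra_closed(3)[of 1 "lpa_gens G" 1]
      by (intro lpa_ideal_closed(2)[OF wf_digraph] unit_left unit_nonunital) simp
    finally have "lpa_map (1 - lpa_unit :: ('a, 'b, 'k) lpa_poly) \<in> I"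
      by (intro ker) (simp add: restrict_poly_id free_algebra_closed(4) u)
    then show "1 - (\<Sum>v\<in>verts G. gen (Vertex v)) \<in> {p. lpa_map p \<in> I}" by (simp add: lpa_unit_def)
  qed (auto simp: lpa_map_zero lpa_map_add lpa_map_mult I.zero_closed I.a_closed
      I.I_l_closed I.I_r_closed lpa_map_closed)
qed

text \<open>
  The elements all of whose homogeneous components lie in the ideal form an ideal that contains the
  relations. In effect this is the directness of the sum of the graded components of $L_K(E)$.
\<close>

lemma lpa_ideal_homogeneous:
  fixes p :: "('a, 'b, 'k::field) lpa_poly"
  assumes "p \<in> lpa_ideal G"
  shows "homogeneous_part n p \<in> lpa_ideal G"
proof -
  let ?F = "free_algebra (lpa_gens G) :: ('a, 'b, 'k) lpa_poly ring"
  let ?S = "{p \<in> carrier ?F. \<forall>n. homogeneous_part n p \<in> lpa_ideal G}"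
  interpret F: ring ?F by (rule ring_free_algebra)
  interpret I: ideal "lpa_ideal G" ?F by (rule ideal_lpa_ideal[OF wf_digraph])
  have prod: "homogeneous_part n (a * p) \<in> lpa_ideal G \<and> homogeneous_part n (p * a) \<in> lpa_ideal G"
    if p: "p \<in> ?S" and a: "a \<in> carrier ?F" for p a n
  proof -
    let ?s = "\<lambda>w. Poly_Mapping.single w (Poly_Mapping.lookup a w)"
    have s: "?s w \<in> carrier ?F" if "w \<in> Poly_Mapping.keys a" for w
      using a that by (auto simp: free_algebra_carrier_iff)
    have "homogeneous_part n (a * p) = (\<Sum>w\<in>Poly_Mapping.keys a. ?s w * homogeneous_part (n - word_degree w) p)"
      by (subst ncpoly_decomp[of a], simp only: sum_distrib_right filter_words_sum)
        (intro sum.cong refl filter_words_mult_single_left, auto)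
    moreover have "homogeneous_part n (p * a) = (\<Sum>w\<in>Poly_Mapping.keys a. homogeneous_part (n - word_degree w) p * ?s w)"
      by (subst ncpoly_decomp[of a], simp only: sum_distrib_left filter_words_sum)
        (intro sum.cong refl filter_words_mult_single_right, auto)
    moreover have "?s w * homogeneous_part k p \<in> lpa_ideal G" "homogeneous_part k p * ?s w \<in> lpa_ideal G"
      if "w \<in> Poly_Mapping.keys a" for w k
      using p lpa_ideal_closed(2,3)[OF wf_digraph _ s[OF that], of "homogeneous_part k p"] by blast+
    ultimately show ?thesis by (simp add: lpa_ideal_sum[OF wf_digraph])
  qed
  have neg: "\<ominus>\<^bsub>?F\<^esub> p = - p" if "p \<in> carrier ?F" for p
    using that by (intro F.minus_equality) (auto intro: free_algebra_closed)
  have "ideal ?S ?F"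
  proof (rule idealI)
    show "subgroup ?S (add_monoid ?F)"
    proof (rule F.add.subgroupI)
      show "\<ominus>\<^bsub>?F\<^esub> p \<in> ?S" if p: "p \<in> ?S" for p
      proof -
        have "homogeneous_part n (- p) \<in> lpa_ideal G" for n
          using prod[OF p, of "- 1" n] free_algebra_closed(3)[of 1 "lpa_gens G" 1] by simp
        then have "- p \<in> ?S" using p free_algebra_closed(3)[of p "lpa_gens G" p] by auto
        then show ?thesis using neg[of p] p by simp
      qed
      have "0 \<in> ?S" by (simp add: lpa_ideal_closed(4)[OF wf_digraph])
      then show "?S \<noteq> {}" by blast
      show "p \<oplus>\<^bsub>?F\<^esub> q \<in> ?S" if "p \<in> ?S" "q \<in> ?S" for p q
        using that by (simp add: filter_words_add lpa_ideal_closed(1)[OF wf_digraph] free_algebra_closed(1))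
    qed auto
  qed (use prod in \<open>auto simp: ring_free_algebra free_algebra_closed\<close>)
  moreover have "lpa_relations G \<subseteq> ?S"
  proof
    fix r :: "('a, 'b, 'k) lpa_poly" assume r: "r \<in> lpa_relations G"
    obtain d where d: "\<And>n. homogeneous_part n r = (if n = d then r else 0)"
      using homogeneous_relation[OF r] by blast
    have "homogeneous_part n r \<in> lpa_ideal G" for n
      using d[of n] lpa_relations_in_ideal r lpa_ideal_closed(4)[OF wf_digraph] by auto
    then show "r \<in> ?S" using lpa_relations_carrier[OF wf_digraph] r by blast
  qed
  ultimately have "lpa_ideal G \<subseteq> ?S" unfolding lpa_ideal_def by (rule F.genideal_minimal)
  with assms show ?thesis by blast
qed

text \<open>
  If \<open>p\<close> agrees with $\sum q_i$ up to the relations, with each $q_i$ homogeneous of degree \<open>i\<close>,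
  then homogeneity of the relations shows that the component of degree \<open>n\<close> of \<open>p\<close> agrees with
  $q_n$.
\<close>

lemma graded_pullback:
  fixes P :: "('a, 'b, 'k::field) lpa_poly set set"
  assumes P: "graded_ideal G P" and p: "lpa_map p \<in> P"
  shows "lpa_map (homogeneous_part n p) \<in> P"
proof -
  have id: "ideal P LPA" using P by (simp add: graded_ideal_def)
  interpret L: ring "LPA :: ('a, 'b, 'k) lpa_poly set ring" by (rule lpa_ring)
  interpret Z: lpa_congruence G "{p :: ('a, 'b, 'k) lpa_poly. lpa_map p \<in> {\<zero>\<^bsub>LPA\<^esub>}}"
    by (rule lpa_congruence_pullback[OF L.zeroideal])
  interpret Q: lpa_congruence G "{p. lpa_map p \<in> P}"
    by (rule lpa_congruence_pullback[OF id])
  from bspec[OF conjunct2[OF P[unfolded graded_ideal_def]] p]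
  obtain N f where "finite N" and f: "\<forall>i\<in>N. f i \<in> P \<inter> lpa_component G i"
      and sum: "lpa_map p = (\<Oplus>\<^bsub>LPA\<^esub>i\<in>N. f i)"
    by (elim exE conjE) (rule that)
  have N: "finite N" "\<And>i. i \<in> N \<Longrightarrow> f i \<in> P" "\<And>i. i \<in> N \<Longrightarrow> f i \<in> lpa_component G i"
    using f by (auto intro: \<open>finite N\<close>)
  have "\<exists>q. f i = lpa_map q \<and> (\<forall>w\<in>Poly_Mapping.keys q. word_degree w = i)" if "i \<in> N" for i
  proof -
    from N(3)[OF that] obtain q where "q \<in> nonunital_part (lpa_gens G)" "f i = lpa_class G q"
        "\<forall>w\<in>Poly_Mapping.keys q. word_degree w = i"
      unfolding lpa_component_def by auto
    then show ?thesis using lpa_map_nonunital by blast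
  qed
  then obtain q where q: "\<And>i. i \<in> N \<Longrightarrow> f i = lpa_map (q i)"
      "\<And>i w. i \<in> N \<Longrightarrow> w \<in> Poly_Mapping.keys (q i) \<Longrightarrow> word_degree w = i" by metis
  have "lpa_map p = lpa_map (\<Sum>i\<in>N. q i)"
    unfolding lpa_map_sum[OF N(1)] sum by (intro L.finsum_cong') (auto simp: q lpa_map_closed)
  have "lpa_map (p - (\<Sum>i\<in>N. q i)) \<oplus>\<^bsub>LPA\<^esub> lpa_map (\<Sum>i\<in>N. q i) = lpa_map (\<Sum>i\<in>N. q i)"
    using \<open>lpa_map p = lpa_map (\<Sum>i\<in>N. q i)\<close> lpa_map_add[of "p - (\<Sum>i\<in>N. q i)" "\<Sum>i\<in>N. q i"] by simp
  then have "lpa_map (p - (\<Sum>i\<in>N. q i)) = \<zero>\<^bsub>LPA\<^esub>"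
    using L.add.r_cancel_one'[OF lpa_map_closed lpa_map_closed] L.add.l_cancel_one[OF lpa_map_closed lpa_map_closed]
    by metis
  then have "homogeneous_part n (lpa_unit * restrict_poly (p - (\<Sum>i\<in>N. q i))) \<in> lpa_ideal G"
    unfolding lpa_map_eq_zero_iff by (rule lpa_ideal_homogeneous)
  moreover have "homogeneous_part n (lpa_unit * restrict_poly (p - (\<Sum>i\<in>N. q i))) =
      lpa_unit * restrict_poly (homogeneous_part n (p - (\<Sum>i\<in>N. q i)))"
  proof -
    have "word_degree w = 0" if w: "w \<in> Poly_Mapping.keys (lpa_unit :: ('a, 'b, 'k) lpa_poly)" for w
    proof -
      have "filter_words (\<lambda>w. word_degree w = 0) lpa_unit = (lpa_unit :: ('a, 'b, 'k) lpa_poly)"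
        unfolding lpa_unit_def filter_words_sum
        by (intro sum.cong refl) (simp add: gen_def filter_words_single)
      then show ?thesis using w by (metis (mono_tags, lifting) keys_filter_words mem_Collect_eq)
    qed
    from homogeneous_part_mult_left[OF this, where n = n]
    show ?thesis unfolding restrict_poly_def by (simp add: filter_words_swap)
  qed
  ultimately have "lpa_map (homogeneous_part n (p - (\<Sum>i\<in>N. q i))) = \<zero>\<^bsub>LPA\<^esub>"
    by (simp add: lpa_map_eq_zero_iff)
  then have diff: "lpa_map (homogeneous_part n p - (\<Sum>i\<in>N. homogeneous_part n (q i))) \<in> P"
    using Q.zero_mem by (simp add: filter_words_diff filter_words_sum lpa_map_zero)
  have part: "homogeneous_part n (q i) \<in> {p. lpa_map p \<in> P}" if i: "i \<in> N" for i
  proof (cases "n = i")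
    case True
    then have "homogeneous_part n (q i) = q i" using q(2)[OF i] by (intro filter_words_all) auto
    then show ?thesis using N(2)[OF i] q(1)[OF i] by simp
  next
    case False
    then have "homogeneous_part n (q i) = 0" using q(2)[OF i] by (intro filter_words_none) auto
    then show ?thesis using Q.zero_mem by simp
  qed
  let ?s = "\<Sum>i\<in>N. homogeneous_part n (q i)"
  have "?s \<in> {p. lpa_map p \<in> P}" by (rule Q.sum_mem[OF part])
  with diff have "(homogeneous_part n p - ?s) + ?s \<in> {p. lpa_map p \<in> P}"
    by (intro Q.add_mem) simp_all
  then show ?thesis by simp
qed

end

section \<open>Simple modules and primitive ideals\<close>

context left_module begin

lemma smult_zero_left: "x \<in> carrier M \<Longrightarrow> \<zero>\<^bsub>R\<^esub> \<odot> x = \<zero>"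
  using smult_l_distr[of "\<zero>\<^bsub>R\<^esub>" "\<zero>\<^bsub>R\<^esub>" x] smult_closed[of "\<zero>\<^bsub>R\<^esub>" x]
  by (metis M.add.r_cancel_one' R.zero_closed R.r_zero)

lemma smult_zero_right: "a \<in> carrier R \<Longrightarrow> a \<odot> \<zero> = \<zero>"
  using smult_r_distr[of a \<zero> \<zero>] smult_closed[of a \<zero>]
  by (metis M.add.r_cancel_one' M.zero_closed M.r_zero)

lemma smult_uminus: "a \<in> carrier R \<Longrightarrow> x \<in> carrier M \<Longrightarrow> \<ominus> (a \<odot> x) = (\<ominus>\<^bsub>R\<^esub> a) \<odot> x"
  by (rule M.minus_equality)
    (simp_all add: smult_l_distr[symmetric] smult_closed R.l_neg smult_zero_left)

lemma ideal_annihilator: "ideal (module_annihilator R M) R"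
proof (rule idealI)
  show "subgroup (module_annihilator R M) (add_monoid R)"
    by (rule R.add.subgroupI)
      (auto simp: module_annihilator_def smult_zero_left smult_l_distr smult_uminus[symmetric]
        intro!: exI[of _ "\<zero>\<^bsub>R\<^esub>"])
qed (auto simp: module_annihilator_def R.ring_axioms smult_assoc smult_closed smult_zero_right)

lemma submodule_orbit:
  assumes x: "x \<in> carrier M"
  shows "submodule ((\<lambda>a. a \<odot> x) ` carrier R) R M"
proof (intro submodule.intro submodule_axioms.intro M.add.subgroupI)
  show "(\<lambda>a. a \<odot> x) ` carrier R \<subseteq> carrier M" using x smult_closed by auto
  show "(\<lambda>a. a \<odot> x) ` carrier R \<noteq> {}" using R.zero_closed by blast
  show "\<ominus> y \<in> (\<lambda>a. a \<odot> x) ` carrier R" if "y \<in> (\<lambda>a. a \<odot> x) ` carrier R" for y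
    using that x by (auto simp: smult_uminus)
  show "y \<oplus> z \<in> (\<lambda>a. a \<odot> x) ` carrier R"
    if "y \<in> (\<lambda>a. a \<odot> x) ` carrier R" "z \<in> (\<lambda>a. a \<odot> x) ` carrier R" for y z
    using that x by (auto simp: smult_l_distr[symmetric])
  show "a \<odot> y \<in> (\<lambda>a. a \<odot> x) ` carrier R" if "a \<in> carrier R" "y \<in> (\<lambda>a. a \<odot> x) ` carrier R" for a y
    using that x by (auto simp: smult_assoc[symmetric])
qed

end

lemma simple_module_transitive:
  assumes "simple_left_module R M" "x \<in> carrier M" "x \<noteq> \<zero>\<^bsub>M\<^esub>" "y \<in> carrier M"
  obtains a where "a \<in> carrier R" "y = a \<odot>\<^bsub>M\<^esub> x"
proof -
  interpret left_module R M using assms(1) by (simp add: simple_left_module_def)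
  let ?N = "(\<lambda>a. a \<odot>\<^bsub>M\<^esub> x) ` carrier R"
  have "x \<in> ?N" using assms(2) smult_one by (intro image_eqI[of _ _ "\<one>\<^bsub>R\<^esub>"]) auto
  then have "?N = carrier M"
    using submodule_orbit[OF assms(2)] assms(1,3) unfolding simple_left_module_def by blast
  then show ?thesis using assms(4) that by blast
qed

text \<open>
  If \<open>B\<close> moves some \<open>z\<close> to a nonzero $b z$, then \<open>M\<close> is generated by $b z$, so an ideal \<open>A\<close> for
  which $A B$ annihilates \<open>M\<close> already annihilates \<open>M\<close> itself.
\<close>

theorem primitive_imp_prime:
  assumes simple: "simple_left_module R M"
  shows "nc_prime_ideal R (module_annihilator R M)"
proof -
  interpret left_module R M using simple by (simp add: simple_left_module_def)
  let ?P = "module_annihilator R M"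
  obtain x where x: "x \<in> carrier M" "x \<noteq> \<zero>\<^bsub>M\<^esub>"
    using simple M.zero_closed unfolding simple_left_module_def by blast
  have "\<one>\<^bsub>R\<^esub> \<notin> ?P" using x smult_one by (auto simp: module_annihilator_def)
  moreover have "A \<subseteq> ?P"
    if A: "ideal A R" and B: "ideal B R" and AB: "ideal_prod R A B \<subseteq> ?P" and nB: "\<not> B \<subseteq> ?P" for A B
  proof
    fix a assume a: "a \<in> A"
    have carr: "a \<in> carrier R" using ideal.Icarr[OF A a] .
    obtain b z where b: "b \<in> B" "b \<in> carrier R" and z: "z \<in> carrier M" "b \<odot>\<^bsub>M\<^esub> z \<noteq> \<zero>\<^bsub>M\<^esub>"
      using nB ideal.Icarr[OF B] by (auto simp: module_annihilator_def)
    have "a \<odot>\<^bsub>M\<^esub> y = \<zero>\<^bsub>M\<^esub>" if y: "y \<in> carrier M" for y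
    proof -
      obtain c where c: "c \<in> carrier R" "y = c \<odot>\<^bsub>M\<^esub> (b \<odot>\<^bsub>M\<^esub> z)"
        using simple_module_transitive[OF simple smult_closed[OF b(2) z(1)] z(2) y] .
      have "c \<otimes>\<^bsub>R\<^esub> b \<in> B" by (rule ideal.I_l_closed[OF B b(1) c(1)])
      then have "a \<otimes>\<^bsub>R\<^esub> (c \<otimes>\<^bsub>R\<^esub> b) \<in> ?P" using AB ideal_prod.prod[OF a] by blast
      then show ?thesis
        using z(1) c b(2) carr by (auto simp: module_annihilator_def smult_assoc smult_closed)
    qed
    then show "a \<in> ?P" using carr by (simp add: module_annihilator_def)
  qed
  ultimately show ?thesis
    using ideal_annihilator R.one_closed unfolding nc_prime_ideal_def by blast
qed

context fin_digraph begin

lemma primitive_congruence_annihilator: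
  fixes M :: "(('a, 'b, 'k::field) lpa_poly set, 'm) module"
  assumes simple: "simple_left_module LPA M"
    and x: "x \<in> carrier M" "x \<noteq> \<zero>\<^bsub>M\<^esub>"
  shows "primitive_lpa_congruence G {p. lpa_map p \<in> module_annihilator LPA M}
    {p. lpa_map p \<odot>\<^bsub>M\<^esub> x = \<zero>\<^bsub>M\<^esub>}"
proof -
  interpret left_module "LPA :: ('a, 'b, 'k) lpa_poly set ring" M
    using simple by (simp add: simple_left_module_def)
  interpret Q: lpa_congruence G "{p. lpa_map p \<in> module_annihilator LPA M}"
    by (rule lpa_congruence_pullback[OF ideal_annihilator])
  have closed: "lpa_map p \<odot>\<^bsub>M\<^esub> y \<in> carrier M" if "y \<in> carrier M" for p y
    using that by (intro smult_closed lpa_map_closed)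
  have mult: "lpa_map (p * q) \<odot>\<^bsub>M\<^esub> y = lpa_map p \<odot>\<^bsub>M\<^esub> (lpa_map q \<odot>\<^bsub>M\<^esub> y)" if "y \<in> carrier M" for p q y
    using that by (simp add: lpa_map_mult smult_assoc lpa_map_closed)
  have add: "lpa_map (p + q) \<odot>\<^bsub>M\<^esub> y = lpa_map p \<odot>\<^bsub>M\<^esub> y \<oplus>\<^bsub>M\<^esub> lpa_map q \<odot>\<^bsub>M\<^esub> y"
    if "y \<in> carrier M" for p q y
    using that by (simp add: lpa_map_add smult_l_distr lpa_map_closed)
  have trans: "\<exists>a. lpa_map a \<odot>\<^bsub>M\<^esub> y = z" if yz: "y \<in> carrier M" "y \<noteq> \<zero>\<^bsub>M\<^esub>" "z \<in> carrier M" for y z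
  proof -
    obtain a where a: "a \<in> carrier LPA" "z = a \<odot>\<^bsub>M\<^esub> y" by (rule simple_module_transitive[OF simple yz])
    obtain p where "a = lpa_map p" by (rule lpa_map_surj[OF a(1)])
    with a(2) show ?thesis by blast
  qed
  show ?thesis
  proof
    show "p + q \<in> {p. lpa_map p \<odot>\<^bsub>M\<^esub> x = \<zero>\<^bsub>M\<^esub>}"
      if "p \<in> {p. lpa_map p \<odot>\<^bsub>M\<^esub> x = \<zero>\<^bsub>M\<^esub>}" "q \<in> {p. lpa_map p \<odot>\<^bsub>M\<^esub> x = \<zero>\<^bsub>M\<^esub>}" for p q
      using that x by (simp add: add)
    show "a * p \<in> {p. lpa_map p \<odot>\<^bsub>M\<^esub> x = \<zero>\<^bsub>M\<^esub>}"
      if "p \<in> {p. lpa_map p \<odot>\<^bsub>M\<^esub> x = \<zero>\<^bsub>M\<^esub>}" for a p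
      using that x by (simp add: mult smult_zero_right lpa_map_closed)
    show "1 \<notin> {p. lpa_map p \<odot>\<^bsub>M\<^esub> x = \<zero>\<^bsub>M\<^esub>}" using x by (simp add: lpa_map_one smult_one)
    show "\<exists>a. a * p - 1 \<in> {p. lpa_map p \<odot>\<^bsub>M\<^esub> x = \<zero>\<^bsub>M\<^esub>}"
      if "p \<notin> {p. lpa_map p \<odot>\<^bsub>M\<^esub> x = \<zero>\<^bsub>M\<^esub>}" for p
    proof -
      from that trans[OF closed[OF x(1)] _ x(1), of p]
      obtain a where a: "lpa_map (a * p) \<odot>\<^bsub>M\<^esub> x = x" using x by (auto simp: mult)
      have "lpa_map (a * p - 1) \<odot>\<^bsub>M\<^esub> x \<oplus>\<^bsub>M\<^esub> x = x"
        using add[OF x(1), of "a * p - 1" 1] a x by (simp add: lpa_map_one smult_one)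
      then have "lpa_map (a * p - 1) \<odot>\<^bsub>M\<^esub> x = \<zero>\<^bsub>M\<^esub>"
        by (simp add: M.add.r_cancel_one x(1) closed)
      then show ?thesis by blast
    qed
    show "p \<in> {p. lpa_map p \<in> module_annihilator LPA M} \<longleftrightarrow>
        (\<forall>a. p * a \<in> {p. lpa_map p \<odot>\<^bsub>M\<^esub> x = \<zero>\<^bsub>M\<^esub>})" for p
    proof
      assume "p \<in> {p. lpa_map p \<in> module_annihilator LPA M}"
      then show "\<forall>a. p * a \<in> {p. lpa_map p \<odot>\<^bsub>M\<^esub> x = \<zero>\<^bsub>M\<^esub>}"
        using x closed by (simp add: mult module_annihilator_def)
    next
      assume *: "\<forall>a. p * a \<in> {p. lpa_map p \<odot>\<^bsub>M\<^esub> x = \<zero>\<^bsub>M\<^esub>}"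
      have "lpa_map p \<odot>\<^bsub>M\<^esub> y = \<zero>\<^bsub>M\<^esub>" if y: "y \<in> carrier M" for y
      proof -
        obtain a where "lpa_map a \<odot>\<^bsub>M\<^esub> x = y" using trans[OF x y] by blast
        then show ?thesis using * x(1) by (auto simp: mult)
      qed
      then show "p \<in> {p. lpa_map p \<in> module_annihilator LPA M}"
        by (simp add: module_annihilator_def lpa_map_closed)
    qed
  qed
qed

lemma graded_ideal_eq_pair_ideal:
  fixes P :: "('a, 'b, 'k::field) lpa_poly set set"
  assumes graded: "graded_ideal G P"
  shows "pair_ideal G {v \<in> verts G. lpa_map (vert_poly v) \<in> P} {} = P"
proof -
  let ?H = "{v \<in> verts G. lpa_map (vert_poly v) \<in> P}"
  have P: "ideal P LPA" using graded by (simp add: graded_ideal_def)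
  interpret L: ring "LPA :: ('a, 'b, 'k) lpa_poly set ring" by (rule lpa_ring)
  interpret P: ideal P LPA by fact
  interpret Q: lpa_congruence G "{p. lpa_map p \<in> P}" by (rule lpa_congruence_pullback[OF P])
  let ?gens = "(\<lambda>v. lpa_class G (vert_poly v)) ` ?H :: ('a, 'b, 'k) lpa_poly set set"
  define I :: "('a, 'b, 'k) lpa_poly set set" where "I = pair_ideal G ?H {}"
  have I: "I = Idl\<^bsub>LPA\<^esub> ?gens" by (simp add: I_def pair_ideal_def)
  have class_vert: "lpa_class G (vert_poly v :: ('a, 'b, 'k) lpa_poly) = lpa_map (vert_poly v)"
    if "v \<in> verts G" for v
    using that by (intro lpa_map_nonunital[symmetric] gen_nonunital) (simp add: lpa_gens_def)
  have gens_P: "?gens \<subseteq> P" by (auto simp: class_vert)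
  then have gens_L: "?gens \<subseteq> carrier LPA" using P.Icarr by blast
  have I_ideal: "ideal I LPA" unfolding I by (rule L.genideal_ideal[OF gens_L])
  have IP: "I \<subseteq> P" unfolding I by (rule L.genideal_minimal[OF P gens_P])
  interpret QI: lpa_congruence G "{p. lpa_map p \<in> I}" by (rule lpa_congruence_pullback[OF I_ideal])
  have "{p. lpa_map p \<in> P} \<subseteq> {p. lpa_map p \<in> I}"
  proof (rule QI.graded_congruence_le)
    show "lpa_congruence G {p. lpa_map p \<in> P}" by (rule Q.lpa_congruence_axioms)
    show "{p. lpa_map p \<in> I} \<subseteq> {p. lpa_map p \<in> P}" using IP by blast
    show "homogeneous_part n p \<in> {p. lpa_map p \<in> P}" if "p \<in> {p. lpa_map p \<in> P}" for p n
      using that graded_pullback[OF graded] by simp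
    show "vert_poly v \<in> {p. lpa_map p \<in> I}" if "vert_poly v \<in> {p. lpa_map p \<in> P}" for v
    proof (cases "v \<in> verts G")
      case True
      with that have "lpa_class G (vert_poly v) \<in> ?gens" by blast
      then have "lpa_class G (vert_poly v) \<in> I" unfolding I using L.genideal_self[OF gens_L] by blast
      then show ?thesis using class_vert[OF True] by simp
    qed (rule QI.outside_vertex)
  qed
  then have "P \<subseteq> I" using P.Icarr lpa_map_surj by (metis (mono_tags, lifting) mem_Collect_eq subset_iff)
  with IP show ?thesis by (simp add: I_def)
qed

section \<open>Quotient graphs\<close>

lemma breaking_vertices_empty: "breaking_vertices G H = {}"
  by (auto simp: breaking_vertices_def infinite_emitter_def)

abbreviation quot :: "'a set \<Rightarrow> ('a + 'a, 'b + 'b) pre_digraph"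
  where "quot H \<equiv> quotient_graph G H {}"

lemma verts_quot: "verts (quot H) = Inl ` (verts G - H)"
  and arcs_quot: "arcs (quot H) = Inl ` {e \<in> arcs G. head G e \<notin> H}"
  and tail_quot: "tail (quot H) (Inl e) = Inl (tail G e)"
  and head_quot: "head (quot H) (Inl e) = Inl (head G e)"
  by (auto simp: quotient_graph_def breaking_vertices_empty)

lemma fin_digraph_quot:
  assumes "hereditary G H"
  shows "fin_digraph (quot H)"
proof
  fix e assume "e \<in> arcs (quot H)"
  then obtain f where f: "e = Inl f" "f \<in> arcs G" "head G f \<notin> H" by (auto simp: arcs_quot)
  have "tail G f \<rightarrow>\<^sup>* head G f" using f(2) by (intro reachable_adjI) (auto simp: arcs_ends_conv)
  then have "tail G f \<notin> H" using f(3) assms unfolding hereditary_def by blast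
  with f show "tail (quot H) e \<in> verts (quot H)" "head (quot H) e \<in> verts (quot H)"
    by (auto simp: verts_quot tail_quot head_quot)
qed (auto simp: verts_quot arcs_quot)

text \<open>
  By heredity, a path whose range avoids \<open>H\<close> avoids \<open>H\<close> altogether.
\<close>

lemma reachable_quot:
  assumes "hereditary G H" "u \<rightarrow>\<^sup>* w" "w \<notin> H"
  shows "Inl u \<rightarrow>\<^sup>*\<^bsub>quot H\<^esub> Inl w"
proof -
  interpret F: fin_digraph "quot H" by (rule fin_digraph_quot[OF assms(1)])
  show ?thesis
    using assms(2)
  proof (induction rule: converse_reachable_induct)
    case base
    then show ?case using assms(3) by (intro F.reachable_refl) (simp add: verts_quot)
  next
    case (step x y)
    obtain e where e: "e \<in> arcs G" "tail G e = x" "head G e = y" using step.hyps(1) by (rule reachableE)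
    have "Inl y \<in> verts (quot H)" using F.reachable_in_verts(1)[OF step.IH] .
    then have "Inl e \<in> arcs (quot H)" using e by (auto simp: verts_quot arcs_quot)
    then have "Inl x \<rightarrow>\<^bsub>quot H\<^esub> Inl y" using e by (force simp: arcs_ends_conv tail_quot head_quot)
    then show ?case using step.IH by (rule F.adj_reachable_trans)
  qed
qed

end

text \<open>
  Finitely many applications of directedness give a vertex \<open>w\<close> below all others, and every
  non-empty hereditary set contains \<open>w\<close>.
\<close>

lemma (in fin_digraph) strong_CSP_if_downward_directed:
  assumes "downward_directed_graph G"
  shows "strong_CSP G"
proof -
  have "\<exists>w\<in>verts G. \<forall>u\<in>A. u \<rightarrow>\<^sup>* w" if "finite A" "A \<subseteq> verts G" for A
    using that
  proof (induction A)
    case empty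
    then show ?case using assms by (auto simp: downward_directed_graph_def)
  next
    case (insert u A)
    then obtain w where w: "w \<in> verts G" "\<forall>u\<in>A. u \<rightarrow>\<^sup>* w" by auto
    with insert.prems assms obtain z where "z \<in> verts G" "u \<rightarrow>\<^sup>* z" "w \<rightarrow>\<^sup>* z"
      unfolding downward_directed_graph_def by blast
    then show ?case using w reachable_trans by blast
  qed
  from this[OF finite_verts] obtain w where w: "w \<in> verts G" "\<forall>u\<in>verts G. u \<rightarrow>\<^sup>* w" by blast
  show ?thesis
    unfolding strong_CSP_def
  proof (intro exI[of _ "{w}"] conjI allI impI)
    fix H assume H: "H \<noteq> {} \<and> hereditary G H \<and> saturated G H"
    then obtain u where "u \<in> H" "u \<in> verts G" by (auto simp: hereditary_def)
    then show "{w} \<subseteq> H" using H w(2) by (auto simp: hereditary_def)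
  qed (use w in auto)
qed

lemma (in pre_digraph) cas_heads:
  "cas u p w \<Longrightarrow> head G ` set p \<subseteq> insert w (tail G ` set p)"
proof (induction p arbitrary: u)
  case (Cons e p)
  then show ?case by (cases p) auto
qed simp

context fin_digraph begin

text \<open>
  On an exitless cycle of the quotient graph each vertex has exactly one outgoing edge with range
  outside \<open>H\<close>, which is the successor function that \<open>no_exitless_cycle\<close> asks for.
\<close>

lemma condition_L_quot:
  fixes Q :: "('a, 'b, 'k::field) lpa_poly set"
  assumes prim: "primitive_lpa_congruence G Q \<Lambda>"
    and graded: "\<And>p n. p \<in> Q \<Longrightarrow> homogeneous_part n p \<in> Q"
  shows "condition_L (quot {v \<in> verts G. vert_poly v \<in> Q})"
  unfolding condition_L_def
proof (intro allI impI, rule ccontr)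
  interpret primitive_lpa_congruence G Q \<Lambda> by fact
  let ?H = "{v \<in> verts G. vert_poly v \<in> Q}"
  interpret F: pre_digraph "quot ?H" .
  fix p assume p: "is_cycle (quot ?H) p" and noexit: "\<nexists>f. is_exit (quot ?H) p f"
  obtain u where u: "F.awalk u p u" "p \<noteq> []" using p by (auto simp: is_cycle_def)
  have p_arcs: "set p \<subseteq> Inl ` {e \<in> arcs G. head G e \<notin> ?H}"
    using u(1) unfolding F.awalk_def arcs_quot by blast
  have "u \<in> tail (quot ?H) ` set p" using u F.cas_simp[of p u u] by (auto simp: F.awalk_def)
  then have heads: "head (quot ?H) ` set p \<subseteq> tail (quot ?H) ` set p"
    using F.cas_heads[of u p u] u(1) by (auto simp: F.awalk_def)
  define C where "C = {tail G e | e. Inl e \<in> set p}"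
  define nxt where "nxt x = (SOME e. Inl e \<in> set p \<and> tail G e = x)" for x
  have nxt: "Inl (nxt x) \<in> set p \<and> tail G (nxt x) = x" if "x \<in> C" for x
    unfolding nxt_def by (rule someI_ex) (use that in \<open>auto simp: C_def\<close>)
  show False
  proof (rule no_exitless_cycle[OF graded, where C = C and nxt = nxt])
    obtain e where "e \<in> set p" using u(2) by (cases p) auto
    then show "C \<noteq> {}" using p_arcs by (auto simp: C_def)
    show "vert_poly x \<notin> Q" if "x \<in> C" for x
    proof
      assume x: "vert_poly x \<in> Q"
      have e: "nxt x \<in> arcs G" "head G (nxt x) \<notin> ?H" using nxt[OF that] p_arcs by auto
      have "tail G (nxt x) \<rightarrow>\<^sup>* head G (nxt x)" using e(1) by (intro reachable_adjI) (auto simp: arcs_ends_conv)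
      then have "x \<rightarrow>\<^sup>* head G (nxt x)" using nxt[OF that] by simp
      then show False using vertex_mem_reachable[OF _ x] e by simp
    qed
    show "nxt x \<in> arcs G \<and> tail G (nxt x) = x \<and> head G (nxt x) \<in> C" if "x \<in> C" for x
    proof -
      have "head (quot ?H) (Inl (nxt x)) \<in> tail (quot ?H) ` set p"
        using heads nxt[OF that] by blast
      then have "Inl (head G (nxt x)) \<in> tail (quot ?H) ` set p" by (simp only: head_quot)
      then obtain e where "Inl e \<in> set p" "Inl (head G (nxt x)) = tail (quot ?H) (Inl e)"
        using p_arcs by blast
      then have "head G (nxt x) \<in> C" unfolding C_def tail_quot by blast
      then show ?thesis using nxt[OF that] p_arcs by auto
    qed
    show "vert_poly (head G f) \<in> Q"
      if "x \<in> C" "f \<in> arcs G" "tail G f = x" "f \<noteq> nxt x" for x f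
    proof (rule ccontr)
      assume "vert_poly (head G f) \<notin> Q"
      then have "is_exit (quot ?H) p (Inl f)"
        using that nxt[OF that(1)] unfolding is_exit_def
        by (intro conjI bexI[of _ "Inl (nxt x)"]) (auto simp: arcs_quot tail_quot)
      with noexit show False by blast
    qed
  qed
qed

end

theorem proposition3p14:
  fixes E :: "('v, 'e) pre_digraph"
    and P :: "('v, 'e, 'k::field) lpa_poly set set"
  assumes "fin_digraph E"
    and "primitive_ideal TYPE('m) (leavitt_path_algebra E) P"
  shows "strongly_primitive E P"
proof -
  interpret E: fin_digraph E by fact
  obtain M :: "(('v, 'e, 'k) lpa_poly set, 'm) module"
    where simple: "simple_left_module (leavitt_path_algebra E) M"
      and P: "P = module_annihilator (leavitt_path_algebra E) M"
    using assms(2) by (auto simp: primitive_ideal_def)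
  have prime: "nc_prime_ideal (leavitt_path_algebra E) P"
    unfolding P by (rule primitive_imp_prime[OF simple])
  show ?thesis
  proof (cases "graded_ideal E P")
    case False
    with prime show ?thesis by (simp add: strongly_primitive_def)
  next
    case True
    let ?Q = "{p. E.lpa_map p \<in> P}"
    define H where "H = {v \<in> verts E. vert_poly v \<in> ?Q}"
    interpret left_module "leavitt_path_algebra E" M using simple by (simp add: simple_left_module_def)
    obtain x where x: "x \<in> carrier M" "x \<noteq> \<zero>\<^bsub>M\<^esub>"
      using simple M.zero_closed unfolding simple_left_module_def by blast
    note prim = E.primitive_congruence_annihilator[OF simple x, folded P]
    interpret primitive_lpa_congruence E ?Q "{p. E.lpa_map p \<odot>\<^bsub>M\<^esub> x = \<zero>\<^bsub>M\<^esub>}" by (rule prim)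
    have H_iff: "v \<in> H \<longleftrightarrow> v \<in> verts E \<and> vert_poly v \<in> ?Q" for v by (simp add: H_def)
    have graded: "homogeneous_part n p \<in> ?Q" if "p \<in> ?Q" for n p
      using that E.graded_pullback[OF True] by simp
    have her: "hereditary E H"
      unfolding hereditary_def using vertex_mem_reachable E.reachable_in_verts(2) by (auto simp: H_def)
    have sat: "saturated E H"
      unfolding saturated_def
    proof (intro allI impI)
      fix v assume "regular_vertex E v \<and> head E ` out_arcs E v \<subseteq> H"
      then have v: "v \<in> verts E" "out_arcs E v \<noteq> {}" "\<And>e. e \<in> out_arcs E v \<Longrightarrow> vert_poly (head E e) \<in> ?Q"
        unfolding regular_vertex_def using H_iff by blast+
      from vertex_mem_regular[OF v] show "v \<in> H" using v(1) H_iff by blast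
    qed
    have gp: "graded_part E P = P"
      unfolding graded_part_def by (rule Greatest_equality) (auto simp: True)
    have pair: "pair_ideal E H {} = P"
      using E.graded_ideal_eq_pair_ideal[OF True] by (simp add: H_def)
    have dd: "downward_directed_graph (quotient_graph E H {})"
      unfolding downward_directed_graph_def
    proof (intro conjI ballI)
      show "verts (quotient_graph E H {}) \<noteq> {}"
        using vertex_not_mem by (auto simp: E.verts_quot H_def)
    next
      fix a b assume "a \<in> verts (quotient_graph E H {})" "b \<in> verts (quotient_graph E H {})"
      then obtain u v where uv: "a = Inl u" "b = Inl v" "vert_poly u \<notin> ?Q" "vert_poly v \<notin> ?Q"
        by (auto simp: E.verts_quot H_def)
      from common_descendant[OF uv(3,4)] obtain w where
        w: "vert_poly w \<notin> ?Q" "u \<rightarrow>\<^sup>*\<^bsub>E\<^esub> w" "v \<rightarrow>\<^sup>*\<^bsub>E\<^esub> w" by blast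
      then have "w \<in> verts E" "w \<notin> H" using E.reachable_in_verts(2) H_iff by blast+
      then show "\<exists>c\<in>verts (quotient_graph E H {}).
          a \<rightarrow>\<^sup>*\<^bsub>quotient_graph E H {}\<^esub> c \<and> b \<rightarrow>\<^sup>*\<^bsub>quotient_graph E H {}\<^esub> c"
        using uv w E.reachable_quot[OF her] by (intro bexI[of _ "Inl w"]) (auto simp: E.verts_quot)
    qed
    have L: "condition_L (quotient_graph E H {})"
      unfolding H_def by (rule E.condition_L_quot[OF prim graded])
    interpret F: fin_digraph "quotient_graph E H {}" by (rule E.fin_digraph_quot[OF her])
    have "strong_CSP (quotient_graph E H {})" by (rule F.strong_CSP_if_downward_directed[OF dd])
    moreover have "admissible_pair E H {}" using her sat by (simp add: admissible_pair_def)
    moreover have "ideal P (leavitt_path_algebra E)" using True by (simp add: graded_ideal_def)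
    ultimately show ?thesis unfolding strongly_primitive_def using gp pair dd L by metis
  qed
qed

end
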